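(* Let $X=(X_i)_{i\in\mathbb{Z}}$ be i.i.d. Rademacher random variables with $\mathbb{P}(X_i=1)=\mathbb{P}(X_i=-1)=1/2$, and set $\xi_i:=(X_i+1)/2$. For each $n\in\mathbb{N}$ let $(a^{(n)}_i)_{i\in\mathbb{Z}}$ be a summable double-sided sequence of real numbers, and define $$G_n:=\sum_{i\in\mathbb{Z}} a^{(n)}_i\,\xi_i\xi_{i+1},\qquad F_n:=\frac{G_n-\mathbb{E}[G_n]}{\sqrt{\operatorname{Var}(G_n)}},\qquad C_n:=\frac{\|a^{(n)}\|_{l^4(\mathbb{Z})}^2}{\operatorname{Var}(G_n)},$$ where $\|a\|_{l^p(\mathbb{Z})}=(\sum_{i\in\mathbb{Z}}|a_i|^p)^{1/p}$. Then there are constants $K,c>0$ depending only on the coefficient sequence $(a^{(n)}_i)_{i\in\mathbb{Z}}$ such that, with $$\gamma_n(z):=e^{c\,z\,(\operatorname{Var}(G_n))^{-1/2}}\Big(z^{1/2}C_n^{1/2}+(1+z^{1/2}+z)\,C_n\Big),$$ we have $$\Big|\frac{\mathbb{P}(F_n>z)}{1-\Phi(z)}-1\Big|\le K\,(1+z^2)\,\gamma_n(z)$$ for all $0\le z\le \min\{C_n^{-1/5},C_n^{-1/3},C_n^{-2/5},\operatorname{Var}(G_n)^{1/2}\}$ such that $(1+z^2)\gamma_n(z)\le 1$. Here $\Phi$ is the standard normal distribution function.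
   Context: $\operatorname{Var}(G_n)>0$ is implicitly assumed so that $F_n$ is defined. The paper writes the conclusion as $\frac{\mathbb{P}(F_n>z)}{1-\Phi(z)}=1+O(1)(1+z^2)\gamma_n(z)$ with $\gamma_n(z)=e^{O(1)z\operatorname{Var}(G_n)^{-1/2}}(\dots)$, where each $O(1)$ is bounded by a constant depending only on the coefficient sequence. *)

theory Defs
  imports "HOL-Probability.Probability"
begin

definition Phi :: "real \<Rightarrow> real" where
  "Phi z = measure (density lborel std_normal_density) {..z}"

definition lp_norm :: "real \<Rightarrow> (int \<Rightarrow> real) \<Rightarrow> real" where
  "lp_norm p a = (\<Sum>\<^sub>\<infinity>i. \<bar>a i\<bar> powr p) powr (1 / p)"

definition xi :: "(int \<Rightarrow> 'w \<Rightarrow> real) \<Rightarrow> int \<Rightarrow> 'w \<Rightarrow> real" where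
  "xi X i \<omega> = (X i \<omega> + 1) / 2"

definition Gsum :: "(int \<Rightarrow> real) \<Rightarrow> (int \<Rightarrow> 'w \<Rightarrow> real) \<Rightarrow> 'w \<Rightarrow> real" where
  "Gsum a X \<omega> = (\<Sum>\<^sub>\<infinity>i. a i * xi X i \<omega> * xi X (i + 1) \<omega>)"

end

(*
Write F for the normalised sum and d k, u k for D_k F and - D_k L^{-1} F in the sense of discrete
Malliavin calculus.  As F = sum_k X_k u_k with u_k independent of X_k, flipping X_k gives the
integration by parts E[F g(F)] = sum_k E[u_k D_k g(F)].  Inserting the solution f of the Stein
equation for the indicator of (z, oo), the discrete difference D_k f(F) is replaced by d_k f'(F);
since w f(w) and the indicator are monotone in w, the error is again of the form D_k r(F) and a
second integration by parts moves the difference off r.  This yields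
  |P(F > z) - P(N > z)| <= E|A f'(F)| + 2 E|B r(F)|
with A = 1 - sum_k u_k d_k and B = sum_k X_k |u_k| d_k, both of L^2 size C.  Under exponential
tilting by exp(t F) they remain of size C (1 + t), which also gives E exp(t F) <= K exp(t^2/2) as
long as t^3 C stays bounded.  Since f' and r are dominated by P(N > z) times a sum of exponentials
exp(j w - j^2/2), j <= z + 1, the relative error is at most K C (1 + z) (1 + z^2); this is
stronger than the claim, with c = 1 and K universal.  Infinitely supported sequences are
approximated by truncation.
*)
theory Submission
  imports Defs
begin

section \<open>The Gaussian tail and Stein's equation\<close>

text \<open>The indicator may jump by 1 under a single flip, however small \<open>d k\<close> is, so
  estimating the remainder of the Stein solution summand by summand would lose the rate. The way out
  is the shape of \<open>stein_taylor\<close>: its bound is a product of two increments of equal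
  sign, written without absolute values, hence linear in the increment of \<open>stein_mono\<close>.
  It can therefore be integrated by parts against |u k| d k, a weight free of x k. The resulting sum
  B carries the signs x k and cancels, whereas the sum of |u k| |d k| is of order one. The l^4 norm
  enters through a local scale \<open>mu k\<close>: its fourth powers sum to O(C^2), its squares to
  O(1) at unit variance, and so, by Cauchy-Schwarz, its cubes to O(C). Tilting does no harm because
  t |d k| stays bounded, so that a flip changes exp (t F) by a bounded factor only. The tilted first
  moment of A or B is then bounded by a quadratic inequality in which it occurs on both
  sides.\<close>

lemma Phi_eq_cdf: "Phi z = cdf (density lborel std_normal_density) z"
  by (simp add: Phi_def cdf_def)

lemma real_distribution_std_normal: "real_distribution (density lborel std_normal_density)"
proof -
  interpret prob_space "density lborel std_normal_density"
    by (rule prob_space_normal_density) simp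
  show ?thesis by unfold_locales auto
qed

lemma Phi_diff:
  assumes "x \<le> y"
  shows "Phi y - Phi x = integral {x..y} std_normal_density"
proof (cases "x = y")
  case False
  then have xy: "x < y" using assms by simp
  interpret real_distribution "density lborel std_normal_density"
    by (rule real_distribution_std_normal)
  have int: "integrable lborel std_normal_density" by simp
  have si: "set_integrable lborel S std_normal_density" if "S \<in> sets borel" for S
    unfolding set_integrable_def
    by (rule integrable_mult_indicator) (use that int in auto)
  have "Phi y - Phi x = measure (density lborel std_normal_density) {x<..y}"
    unfolding Phi_eq_cdf by (rule cdf_diff_eq) (use xy in simp)
  also have "\<dots> = (\<integral>t. indicator {x<..y} t \<partial>density lborel std_normal_density)" by simp
  also have "\<dots> = (LINT t:{x<..y}|lborel. std_normal_density t)"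
    unfolding set_lebesgue_integral_def
    by (subst integral_density) (auto simp: mult.commute)
  also have "\<dots> = integral {x<..y} std_normal_density"
    by (rule set_borel_integral_eq_integral(2)) (rule si, simp)
  also have "\<dots> = integral {x..y} std_normal_density"
  proof (rule integral_spike_set)
    have "negligible {x}" by simp
    then show "negligible {t \<in> {x<..y} - {x..y}. std_normal_density t \<noteq> 0}"
      and "negligible {t \<in> {x..y} - {x<..y}. std_normal_density t \<noteq> 0}"
      by (rule negligible_subset, auto)+
  qed
  finally show ?thesis .
qed simp

lemma continuous_on_std_normal: "continuous_on S std_normal_density"
  unfolding std_normal_density_def by (intro continuous_intros) auto

lemma DERIV_Phi: "(Phi has_real_derivative std_normal_density x) (at x)"
proof -
  have "((\<lambda>t. integral {x-1..t} std_normal_density) has_real_derivative std_normal_density x)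
          (at x within {x-1..x+1})"
    by (rule integral_has_real_derivative[OF continuous_on_std_normal]) simp
  then have "((\<lambda>t. Phi (x-1) + integral {x-1..t} std_normal_density) has_real_derivative
       0 + std_normal_density x) (at x within {x-1..x+1})"
    by (intro DERIV_add DERIV_const)
  moreover have "Phi (x-1) + integral {x-1..t} std_normal_density = Phi t" if "t \<in> {x-1..x+1}" for t
    using Phi_diff[of "x-1" t] that by simp
  ultimately have "(Phi has_real_derivative std_normal_density x) (at x within {x-1..x+1})"
    by (auto intro: has_field_derivative_transform_within[where d=1])
  then show ?thesis
    by (simp add: at_within_Icc_at)
qed

lemma DERIV_Phi_chain [derivative_intros]:
  assumes "(g has_real_derivative g') (at x within S)"
  shows "((\<lambda>x. Phi (g x)) has_real_derivative (std_normal_density (g x) * g')) (at x within S)"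
  using DERIV_chain2[OF DERIV_Phi assms] by simp

lemma DERIV_std_normal [derivative_intros]:
  assumes "(g has_real_derivative g') (at x within S)"
  shows "((\<lambda>x. std_normal_density (g x)) has_real_derivative
          - g x * std_normal_density (g x) * g') (at x within S)"
  unfolding std_normal_density_def
  by (rule derivative_eq_intros refl assms | simp add: power2_eq_square)+

lemma Phi_at_top: "(Phi \<longlongrightarrow> 1) at_top"
proof -
  interpret real_distribution "density lborel std_normal_density"
    by (rule real_distribution_std_normal)
  show ?thesis using cdf_lim_at_top_prob by (simp add: Phi_eq_cdf[abs_def])
qed

lemma Phi_at_bot: "(Phi \<longlongrightarrow> 0) at_bot"
proof -
  interpret real_distribution "density lborel std_normal_density"
    by (rule real_distribution_std_normal)
  show ?thesis using cdf_lim_at_bot by (simp add: Phi_eq_cdf[abs_def])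
qed

lemma std_normal_pos: "std_normal_density x > 0"
  by (simp add: std_normal_density_def)

lemma std_normal_minus: "std_normal_density (- x) = std_normal_density x"
  by (simp add: std_normal_density_def)

lemma Phi_minus: "Phi (- x) = 1 - Phi x"
proof -
  have "((\<lambda>x. Phi (- x) + Phi x) has_real_derivative 0) (at x)" for x
    by (auto intro!: derivative_eq_intros simp: std_normal_minus)
  then obtain c where c: "\<And>x. Phi (- x) + Phi x = c"
    using DERIV_isconst_all by blast
  have "((\<lambda>x. Phi (- x) + Phi x) \<longlongrightarrow> 0 + 1) at_top"
    by (intro tendsto_add Phi_at_top filterlim_compose[OF Phi_at_bot] filterlim_uminus_at_bot_at_top)
  then have "c = 1" using c by (simp add: tendsto_const_iff)
  then show ?thesis using c[of x] by simp
qed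

lemma Phi_less_1: "Phi x < 1"
proof -
  have "0 < 1 - Phi x"
  proof (rule DERIV_neg_imp_decreasing_at_top[where f="\<lambda>x. 1 - Phi x"])
    show "\<exists>y. ((\<lambda>x. 1 - Phi x) has_real_derivative y) (at t) \<and> y < 0" for t
      by (rule exI[of _ "- std_normal_density t"])
         (auto intro!: derivative_eq_intros simp: std_normal_pos)
    show "((\<lambda>x. 1 - Phi x) \<longlongrightarrow> 0) at_top"
      using tendsto_diff[OF tendsto_const[of 1] Phi_at_top] by simp
  qed
  then show ?thesis by simp
qed

lemma Phi_pos: "Phi x > 0"
  using Phi_less_1[of "-x"] by (simp add: Phi_minus)

section \<open>Mills-type inequalities for the Gaussian tail\<close>

lemma std_normal_tendsto: "(std_normal_density \<longlongrightarrow> 0) at_top"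
  unfolding std_normal_density_def by real_asymp

text \<open>After division by \<open>w\<close>, the difference of the two sides is strictly
  decreasing with limit 0 at infinity, hence positive. The next two inequalities are proved in the
  same way, after division by \<open>1 + w^2\<close> and by \<open>z + 2\<close>.\<close>

lemma mills_upper:
  assumes "w > 0" shows "w * (1 - Phi w) < std_normal_density w"
proof -
  have "0 < std_normal_density w / w - (1 - Phi w)"
  proof (rule DERIV_neg_imp_decreasing_at_top[where f="\<lambda>w. std_normal_density w / w - (1 - Phi w)"])
    fix x assume "w \<le> x"
    with assms have x: "x > 0" by simp
    have "((\<lambda>w. std_normal_density w / w - (1 - Phi w)) has_real_derivative
        - std_normal_density x / x\<^sup>2) (at x)"
      using x by (auto intro!: derivative_eq_intros simp: field_simps power2_eq_square)
    moreover have "- std_normal_density x / x\<^sup>2 < 0" using x std_normal_pos[of x] by simp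
    ultimately show "\<exists>y. ((\<lambda>w. std_normal_density w / w - (1 - Phi w)) has_real_derivative y) (at x) \<and> y < 0"
      by blast
  next
    have "((\<lambda>w. std_normal_density w / w - (1 - Phi w)) \<longlongrightarrow> 0 - (1 - 1)) at_top"
      by (intro tendsto_diff tendsto_const Phi_at_top
          tendsto_divide_0[OF std_normal_tendsto] filterlim_at_top_imp_at_infinity filterlim_ident)
    then show "((\<lambda>w. std_normal_density w / w - (1 - Phi w)) \<longlongrightarrow> 0) at_top" by simp
  qed
  with assms show ?thesis by (simp add: field_simps)
qed

lemma mills_lower: "w * std_normal_density w < (1 + w\<^sup>2) * (1 - Phi w)"
proof -
  have p: "1 + x\<^sup>2 > 0" for x :: real by (simp add: add_pos_nonneg)
  have p': "1 + x\<^sup>2 \<noteq> 0" for x :: real using p[of x] by linarith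
  have "0 < (1 - Phi w) - w * std_normal_density w / (1 + w\<^sup>2)"
  proof (rule DERIV_neg_imp_decreasing_at_top[where f="\<lambda>w. (1 - Phi w) - w * std_normal_density w / (1 + w\<^sup>2)"])
    fix x assume "w \<le> x"
    have "((\<lambda>w. (1 - Phi w) - w * std_normal_density w / (1 + w\<^sup>2)) has_real_derivative
        - 2 * std_normal_density x / (1 + x\<^sup>2)\<^sup>2) (at x)"
      apply (rule derivative_eq_intros refl p')+
      using p'[of x] by (simp add: divide_simps) algebra
    moreover have "- 2 * std_normal_density x / (1 + x\<^sup>2)\<^sup>2 < 0"
      using p[of x] std_normal_pos[of x] by simp
    ultimately show "\<exists>y. ((\<lambda>w. (1 - Phi w) - w * std_normal_density w / (1 + w\<^sup>2)) has_real_derivative y) (at x) \<and> y < 0"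
      by blast
  next
    have "((\<lambda>w. w * std_normal_density w / (1 + w\<^sup>2)) \<longlongrightarrow> 0) at_top"
      unfolding std_normal_density_def by real_asymp
    then have "((\<lambda>w. (1 - Phi w) - w * std_normal_density w / (1 + w\<^sup>2)) \<longlongrightarrow> (1 - 1) - 0) at_top"
      by (intro tendsto_diff tendsto_const Phi_at_top)
    then show "((\<lambda>w. (1 - Phi w) - w * std_normal_density w / (1 + w\<^sup>2)) \<longlongrightarrow> 0) at_top" by simp
  qed
  with p[of w] show ?thesis by (simp add: field_simps)
qed

lemma std_normal_le_tail:
  assumes "z \<ge> 0" shows "std_normal_density z \<le> (z + 2) * (1 - Phi z)"
proof -
  have "0 < (1 - Phi z) - std_normal_density z / (z + 2)"
  proof (rule DERIV_neg_imp_decreasing_at_top[where f="\<lambda>z. (1 - Phi z) - std_normal_density z / (z + 2)"])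
    fix x assume "z \<le> x"
    with assms have x: "x \<ge> 0" by simp
    have "((\<lambda>z. (1 - Phi z) - std_normal_density z / (z + 2)) has_real_derivative
        - ((2 * x + 3) * std_normal_density x / (x + 2)\<^sup>2)) (at x)"
      using x by (auto intro!: derivative_eq_intros simp: power2_eq_square) (simp add: divide_simps, algebra)
    moreover have "- ((2 * x + 3) * std_normal_density x / (x + 2)\<^sup>2) < 0"
      using x std_normal_pos[of x] by simp
    ultimately show "\<exists>y. ((\<lambda>z. (1 - Phi z) - std_normal_density z / (z + 2)) has_real_derivative y) (at x) \<and> y < 0"
      by blast
  next
    have "((\<lambda>w. std_normal_density w / (w + 2)) \<longlongrightarrow> 0) at_top"
      unfolding std_normal_density_def by real_asymp
    then have "((\<lambda>w. (1 - Phi w) - std_normal_density w / (w + 2)) \<longlongrightarrow> (1 - 1) - 0) at_top"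
      by (intro tendsto_diff tendsto_const Phi_at_top)
    then show "((\<lambda>w. (1 - Phi w) - std_normal_density w / (w + 2)) \<longlongrightarrow> 0) at_top" by simp
  qed
  with assms show ?thesis by (simp add: field_simps)
qed

text \<open>The Mills ratio m solves m' = w m - 1. Consequently \<open>Phi z * mills w\<close> and
  \<open>(1 - Phi z) * mills (- w)\<close> solve the Stein equation to the right and to the left of
  \<open>z\<close>.\<close>

definition mills :: "real \<Rightarrow> real" where
  "mills w = (1 - Phi w) / std_normal_density w"

lemma DERIV_mills [derivative_intros]:
  assumes "(g has_real_derivative g') (at x within S)"
  shows "((\<lambda>x. mills (g x)) has_real_derivative (g x * mills (g x) - 1) * g') (at x within S)"
proof -
  have "(mills has_real_derivative (w * mills w - 1)) (at w)" for w
    unfolding mills_def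
    using std_normal_pos[of w] by (auto intro!: derivative_eq_intros simp: divide_simps) (simp add: algebra_simps)
  then show ?thesis using DERIV_chain2 assms by blast
qed

lemma mills_pos: "mills w > 0"
  using Phi_less_1[of w] std_normal_pos[of w] by (simp add: mills_def)

lemma mills_le_1: "w * mills w \<le> 1"
proof (cases "w > 0")
  case True then show ?thesis using mills_upper[of w] std_normal_pos[of w] by (simp add: mills_def field_simps)
next
  case False then have "w * mills w \<le> 0" using mills_pos[of w] by (simp add: mult_nonpos_nonneg)
  then show ?thesis by simp
qed

text \<open>The derivative is \<open>(1 + w^2) * mills w - w\<close>; that it is nonnegative is
  \<open>mills_lower\<close> divided by the density.\<close>

lemma mono_times_mills: "x \<le> y \<Longrightarrow> x * mills x \<le> y * mills y"
proof (rule DERIV_nonneg_imp_nondecreasing[where f="\<lambda>x. x * mills x"])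
  fix w
  have "((\<lambda>x. x * mills x) has_real_derivative ((1 + w\<^sup>2) * mills w - w)) (at w)"
    by (rule derivative_eq_intros refl)+ (simp add: algebra_simps power2_eq_square)
  moreover have "(1 + w\<^sup>2) * mills w - w \<ge> 0"
    using mills_lower[of w] std_normal_pos[of w] by (simp add: mills_def field_simps)
  ultimately show "\<exists>y. ((\<lambda>x. x * mills x) has_real_derivative y) (at w) \<and> 0 \<le> y" by blast
qed

text \<open>The functions \<open>stein\<close> and \<open>stein'\<close> satisfy the Stein equation
  \<open>stein' z w - w * stein z w = P(N > z) - indicat_real {z<..} w\<close> for standard normal \<open>N\<close>.
  Both \<open>stein'\<close> and \<open>stein_mono\<close> fix a value at the kink \<open>w = z\<close>.\<close>

definition stein :: "real \<Rightarrow> real \<Rightarrow> real" where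
  "stein z w = (if w \<le> z then (1 - Phi z) * mills (- w) else Phi z * mills w)"

definition stein' :: "real \<Rightarrow> real \<Rightarrow> real" where
  "stein' z w = w * stein z w + (1 - Phi z) - of_bool (w > z)"

definition stein_mono :: "real \<Rightarrow> real \<Rightarrow> real" where
  "stein_mono z w = w * stein z w + of_bool (w > z)"

section \<open>Monotonicity and increments of the Stein solution\<close>

lemma stein_ge: "w \<ge> z \<Longrightarrow> stein z w = Phi z * mills w"
  by (auto simp: stein_def mills_def Phi_minus std_normal_minus)

text \<open>On either side of \<open>z\<close> the function is a positive multiple of
  \<open>w * mills w\<close> or of its reflection. Points on different sides are compared through
  \<open>z\<close>, where the branches agree.\<close>

lemma mono_times_stein:
  assumes "x \<le> y" shows "x * stein z x \<le> y * stein z y"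
proof -
  have below: "x * stein z x \<le> y * stein z y" if "x \<le> y" "y \<le> z" for x y
  proof -
    have "(- y) * mills (- y) \<le> (- x) * mills (- x)" using that by (intro mono_times_mills) simp
    then have "(1 - Phi z) * (x * mills (- x)) \<le> (1 - Phi z) * (y * mills (- y))"
      using Phi_less_1[of z] by (intro mult_left_mono) auto
    with that show ?thesis by (simp add: stein_def algebra_simps)
  qed
  have above: "x * stein z x \<le> y * stein z y" if "x \<le> y" "z \<le> x" for x y
  proof -
    have "Phi z * (x * mills x) \<le> Phi z * (y * mills y)"
      using Phi_pos[of z] mono_times_mills[OF that(1)] by (intro mult_left_mono) auto
    with that show ?thesis by (simp add: stein_ge algebra_simps)
  qed
  show ?thesis
  proof (cases "x \<le> z")
    case True
    then show ?thesis
    proof (cases "y \<le> z")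
      case False
      with True have "x * stein z x \<le> z * stein z z" "z * stein z z \<le> y * stein z y"
        using below[of x z] above[of z y] by auto
      then show ?thesis by simp
    qed (use below assms in auto)
  qed (use above assms in auto)
qed

text \<open>In \<open>stein'\<close> the product \<open>w * stein z w\<close> and the indicator have
  opposite signs. Both are nondecreasing, so adding them instead gives a monotone function whose
  increments dominate those of \<open>stein'\<close>.\<close>

lemma mono_stein_mono: "x \<le> y \<Longrightarrow> stein_mono z x \<le> stein_mono z y"
  using mono_times_stein[of x y z] by (auto simp: stein_mono_def)

lemma stein_increment_aux:
  assumes "p < q" and s: "q \<le> z \<or> z \<le> p"
    and bd: "\<And>s. p < s \<Longrightarrow> s < q \<Longrightarrow> lo \<le> stein' z s \<and> stein' z s \<le> hi"
  shows "lo * (q - p) \<le> stein z q - stein z p \<and> stein z q - stein z p \<le> hi * (q - p)"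
proof -
  \<comment> \<open>The branch in force is continued smoothly to the whole line, so the mean value
    theorem also applies when an end point is the kink \<open>z\<close>. The intermediate point is
    interior, which is why bounds on the open interval suffice.\<close>
  define g where "g = (if q \<le> z then (\<lambda>w. (1 - Phi z) * mills (- w)) else (\<lambda>w. Phi z * mills w))"
  define g' where "g' = (\<lambda>w. if q \<le> z then w * g w + (1 - Phi z) else w * g w - Phi z)"
  have D: "(g has_real_derivative g' w) (at w)" for w
  proof (cases "q \<le> z")
    case True then show ?thesis unfolding g_def g'_def if_P[OF True]
      by - (rule derivative_eq_intros refl | simp add: algebra_simps)+
  next
    case False then show ?thesis unfolding g_def g'_def if_not_P[OF False]
      by - (rule derivative_eq_intros refl | simp add: algebra_simps)+
  qed
  obtain s where s1: "p < s" "s < q" "g q - g p = (q - p) * g' s"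
    using MVT2[OF \<open>p < q\<close>, of g g'] D by blast
  have "g' s = stein' z s" "g q = stein z q" "g p = stein z p"
    using s1 s \<open>p < q\<close> by (auto simp: g_def g'_def stein'_def stein_ge) (auto simp: stein_def)
  with s1 bd[OF s1(1,2)] \<open>p < q\<close> show ?thesis by (simp add: mult.commute)
qed

lemma stein_increment:
  assumes "p < q"
    and bd: "\<And>s. p \<le> s \<Longrightarrow> s \<le> q \<Longrightarrow> lo \<le> stein' z s \<and> stein' z s \<le> hi"
  shows "lo * (q - p) \<le> stein z q - stein z p \<and> stein z q - stein z p \<le> hi * (q - p)"
proof (cases "q \<le> z \<or> z \<le> p")
  case True
  then show ?thesis by (rule stein_increment_aux[OF assms(1)]) (use bd in auto)
next
  case False
  then have *: "p < z" "z < q" by auto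
  have "lo * (z - p) \<le> stein z z - stein z p \<and> stein z z - stein z p \<le> hi * (z - p)"
    using * bd by (intro stein_increment_aux) auto
  moreover have "lo * (q - z) \<le> stein z q - stein z z \<and> stein z q - stein z z \<le> hi * (q - z)"
    using * bd by (intro stein_increment_aux) auto
  ultimately show ?thesis by (auto simp: algebra_simps)
qed

text \<open>Between \<open>q\<close> and \<open>p\<close> the function \<open>stein'\<close>
  deviates from \<open>stein' z p\<close> by at most the increment of \<open>stein_mono\<close> over
  the interval, and the increment bounds integrate this. Monotonicity fixes the sign of the
  right-hand side, so it needs no absolute value.\<close>

lemma stein_taylor:
  "\<bar>stein z p - stein z q - (p - q) * stein' z p\<bar> \<le> (p - q) * (stein_mono z p - stein_mono z q)"
proof -
  define D where "D = \<bar>stein_mono z p - stein_mono z q\<bar>"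
  have bd: "stein' z p - D \<le> stein' z s \<and> stein' z s \<le> stein' z p + D"
    if "min p q \<le> s" "s \<le> max p q" for s
  proof -
    have "\<bar>stein' z s - stein' z p\<bar> \<le> \<bar>s * stein z s - p * stein z p\<bar> + \<bar>of_bool (s > z) - of_bool (p > z)\<bar>"
      unfolding stein'_def by linarith
    also have "\<dots> \<le> D"
    proof (cases "p \<le> q")
      case True
      with that have "p \<le> s" "s \<le> q" by auto
      then show ?thesis using mono_times_stein[of p s z] mono_times_stein[of s q z]
        by (auto simp: D_def stein_mono_def)
    next
      case False
      with that have "q \<le> s" "s \<le> p" by auto
      then show ?thesis using mono_times_stein[of s p z] mono_times_stein[of q s z]
        by (auto simp: D_def stein_mono_def)
    qed
    finally show ?thesis by linarith
  qed
  consider "p < q" | "p = q" | "q < p" by linarith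
  then show ?thesis
  proof cases
    case 1
    have D: "D = stein_mono z q - stein_mono z p" using mono_stein_mono[of p q z] 1 by (simp add: D_def)
    have "(stein' z p - D) * (q - p) \<le> stein z q - stein z p \<and> stein z q - stein z p \<le> (stein' z p + D) * (q - p)"
      using 1 bd by (intro stein_increment) auto
    then have "\<bar>stein z p - stein z q - (p - q) * stein' z p\<bar> \<le> (q - p) * D"
      unfolding abs_le_iff by (simp add: algebra_simps)
    then show ?thesis by (simp add: D algebra_simps)
  next
    case 3
    have D: "D = stein_mono z p - stein_mono z q" using mono_stein_mono[of q p z] 3 by (simp add: D_def)
    have "(stein' z p - D) * (p - q) \<le> stein z p - stein z q \<and> stein z p - stein z q \<le> (stein' z p + D) * (p - q)"
      using 3 bd by (intro stein_increment) auto
    then have "\<bar>stein z p - stein z q - (p - q) * stein' z p\<bar> \<le> (p - q) * D"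
      unfolding abs_le_iff by (simp add: algebra_simps)
    then show ?thesis by (simp add: D)
  qed simp
qed

text \<open>On \<open>(0, z]\<close> the Gaussian factor \<open>exp (w\<^sup>2 / 2)\<close> is replaced by the exponential
  \<open>exp (j * w - j\<^sup>2 / 2)\<close>, \<open>j = \<lceil>w\<rceil>\<close>, and beyond \<open>z\<close> the indicator by \<open>exp (z * w - z\<^sup>2)\<close>, so
  that only exponential moments are needed.\<close>

definition stein_majorant :: "real \<Rightarrow> real \<Rightarrow> real" where
  "stein_majorant z w = (1 - Phi z) * (1 + 5 * (\<Sum>j=1..nat \<lceil>z\<rceil>. real j * exp (real j * w - (real j)\<^sup>2 / 2)))
     + 2 * exp (z * w - z\<^sup>2)"

text \<open>The origin of the factor 5 in \<open>stein_majorant\<close>: sqrt (2 pi) comes from the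
  normal density, and exp (1/2) from rounding \<open>w\<close> up to an integer.\<close>

lemma sqrt_two_pi_exp_half: "sqrt (2 * pi) * exp (1/2) \<le> 5"
proof -
  have "(sqrt (2 * pi) * exp (1/2))\<^sup>2 = 2 * pi * exp (1::real)"
    by (simp add: power_mult_distrib power2_eq_square[of "exp _"] exp_add[symmetric])
  also have "\<dots> \<le> 2 * 4 * 3"
    using pi_less_4 exp_le by (intro mult_mono) auto
  also have "\<dots> \<le> 5\<^sup>2" by simp
  finally show ?thesis by (rule power2_le_imp_le) simp
qed

text \<open>For \<open>w <= 0\<close> the Mills bound leaves at most \<open>1 - Phi z\<close>. On
  \<open>(0, z]\<close> a single summand suffices. Beyond \<open>z\<close> both functions are at
  most 2 in absolute value, while the last exponential of the majorant is at least 1.\<close>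

lemma abs_stein_le_majorant:
  assumes "z \<ge> 0"
  shows "\<bar>stein' z w\<bar> \<le> stein_majorant z w" "\<bar>stein_mono z w\<bar> \<le> stein_majorant z w"
proof -
  define S where "S = (\<Sum>j=1..nat \<lceil>z\<rceil>. real j * exp (real j * w - (real j)\<^sup>2 / 2))"
  have S0: "S \<ge> 0" unfolding S_def by (intro sum_nonneg) auto
  have p: "0 < 1 - Phi z" "Phi z > 0" "Phi z < 1" using Phi_less_1[of z] Phi_pos[of z] by auto
  have "\<bar>stein' z w\<bar> \<le> stein_majorant z w \<and> \<bar>stein_mono z w\<bar> \<le> stein_majorant z w"
  proof -
    consider "w \<le> 0" | "0 < w" "w \<le> z" | "z < w" by linarith
    then show ?thesis
    proof cases
      case 1
      have "0 \<le> (- w) * mills (- w)" "(- w) * mills (- w) \<le> 1"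
        using 1 mills_pos[of "-w"] mills_le_1[of "-w"] by (auto intro: mult_nonpos_nonneg)
      then have "0 \<le> (1 - Phi z) * (- w * mills (- w))" "(1 - Phi z) * (- w * mills (- w)) \<le> (1 - Phi z)"
        using p mult_left_mono[of "- w * mills (- w)" 1 "1 - Phi z"] mult_nonneg_nonneg[of "1 - Phi z" "- w * mills (- w)"]
        by (simp_all del: mult_minus_left)
      moreover have "w * stein z w = - ((1 - Phi z) * (- w * mills (- w)))"
        using 1 assms by (simp add: stein_def)
      ultimately have "w * stein z w \<le> 0" "- (1 - Phi z) \<le> w * stein z w" by linarith+
      moreover have "1 - Phi z \<le> stein_majorant z w"
      proof -
        have "0 \<le> (1 - Phi z) * (5 * S)" using p S0 by simp
        then show ?thesis unfolding stein_majorant_def S_def[symmetric] by (simp add: distrib_left)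
      qed
      ultimately show ?thesis using 1 assms by (simp add: stein'_def stein_mono_def abs_le_iff)
    next
      case 2
      define j where "j = nat \<lceil>w\<rceil>"
      have j: "j \<in> {1..nat \<lceil>z\<rceil>}"
      proof -
        have "0 < \<lceil>w\<rceil>" "\<lceil>w\<rceil> \<le> \<lceil>z\<rceil>" using 2 by (auto intro: ceiling_mono)
        then have "1 \<le> nat \<lceil>w\<rceil>" "nat \<lceil>w\<rceil> \<le> nat \<lceil>z\<rceil>" by linarith+
        then show ?thesis unfolding j_def atLeastAtMost_iff by blast
      qed
      have jw: "w \<le> real j" "real j - 1 < w" using 2 unfolding j_def by linarith+
      \<comment> \<open>Expanding this square shows that the tangent exponential at \<open>j\<close>
        falls short of \<open>exp (w^2 / 2)\<close> by a factor of at most exp (1/2).\<close>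
      have "(real j - w)\<^sup>2 \<le> 1" using jw by (simp add: power2_le_iff_abs_le[of 1, simplified])
      then have e: "w\<^sup>2 / 2 \<le> 1/2 + (real j * w - (real j)\<^sup>2 / 2)" by (simp add: power2_eq_square algebra_simps)
      have "mills (- w) \<le> 1 / std_normal_density w"
        using p Phi_less_1[of w] std_normal_pos[of w]
        by (simp add: mills_def Phi_minus std_normal_minus divide_right_mono)
      also have "1 / std_normal_density w = sqrt (2 * pi) * exp (w\<^sup>2 / 2)"
        by (simp add: std_normal_density_def exp_minus field_simps)
      finally have "w * mills (- w) \<le> real j * (sqrt (2 * pi) * exp (w\<^sup>2 / 2))"
        using jw 2 mills_pos[of "-w"] by (intro mult_mono) auto
      also have "\<dots> \<le> real j * (sqrt (2 * pi) * (exp (1/2) * exp (real j * w - (real j)\<^sup>2 / 2)))"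
        using e unfolding exp_add[symmetric] by (intro mult_left_mono) auto
      also have "\<dots> = (sqrt (2 * pi) * exp (1/2)) * (real j * exp (real j * w - (real j)\<^sup>2 / 2))" by simp
      also have "\<dots> \<le> 5 * (real j * exp (real j * w - (real j)\<^sup>2 / 2))"
        by (intro mult_right_mono sqrt_two_pi_exp_half) simp
      also have "\<dots> \<le> 5 * S" unfolding S_def
        by (intro mult_left_mono member_le_sum[OF j]) auto
      finally have le: "(1 - Phi z) * (w * mills (- w)) \<le> (1 - Phi z) * (5 * S)"
        using p by (intro mult_left_mono) auto
      have ws: "w * stein z w = (1 - Phi z) * (w * mills (- w))" "w * stein z w \<ge> 0"
        using 2 p mills_pos[of "-w"] by (auto simp: stein_def)
      have "stein_majorant z w \<ge> (1 - Phi z) + (1 - Phi z) * (5 * S)"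
        unfolding stein_majorant_def S_def[symmetric] by (simp add: algebra_simps)
      moreover have "stein' z w = w * stein z w + (1 - Phi z)" "stein_mono z w = w * stein z w"
        using 2 by (simp_all add: stein'_def stein_mono_def)
      ultimately show ?thesis using le ws p by linarith
    next
      case 3
      have "0 \<le> w * mills w" "w * mills w \<le> 1" using 3 assms mills_pos[of w] mills_le_1[of w] by auto
      then have "0 \<le> Phi z * (w * mills w)" "Phi z * (w * mills w) \<le> 1"
        using p by (auto intro: mult_le_one)
      moreover have "w * stein z w = Phi z * (w * mills w)" using 3 by (simp add: stein_def)
      moreover have "2 \<le> stein_majorant z w"
      proof -
        have "z * w - z\<^sup>2 = z * (w - z)" by (simp add: power2_eq_square algebra_simps)
        then have "0 \<le> z * w - z\<^sup>2" using 3 assms by simp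
        then have "1 \<le> exp (z * w - z\<^sup>2)" by simp
        moreover have "0 \<le> (1 - Phi z) * (1 + 5 * S)" using p S0 by simp
        ultimately show ?thesis unfolding stein_majorant_def S_def[symmetric] by linarith
      qed
      moreover have "stein' z w = w * stein z w - Phi z" "stein_mono z w = w * stein z w + 1"
        using 3 by (simp_all add: stein'_def stein_mono_def)
      ultimately show ?thesis using p by linarith
    qed
  qed
  then show "\<bar>stein' z w\<bar> \<le> stein_majorant z w" "\<bar>stein_mono z w\<bar> \<le> stein_majorant z w" by auto
qed

section \<open>Sums over a chain of signs\<close>

definition flip :: "int \<Rightarrow> (int \<Rightarrow> real) \<Rightarrow> int \<Rightarrow> real" where
  "flip k x = x(k := - x k)"

text \<open>Points are total functions with the value 1 off \<open>J\<close>. Every coordinate is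
  then a sign, so neighbours of the end points of \<open>J\<close> need no separate
  treatment.\<close>

definition cube :: "int set \<Rightarrow> (int \<Rightarrow> real) set" where
  "cube J = PiE_dflt J 1 (\<lambda>_. {- 1, 1})"

definition avg :: "int set \<Rightarrow> ((int \<Rightarrow> real) \<Rightarrow> real) \<Rightarrow> real" where
  "avg J \<phi> = (\<Sum>x\<in>cube J. \<phi> x) / real (card (cube J))"

lemma flip_flip [simp]: "flip k (flip k x) = x"
  by (auto simp: flip_def)

lemma flip_same [simp]: "flip k x k = - x k"
  by (simp add: flip_def)

lemma flip_other [simp]: "j \<noteq> k \<Longrightarrow> flip k x j = x j"
  by (simp add: flip_def)

lemma cube_cases: "x \<in> cube J \<Longrightarrow> x k = 1 \<or> x k = - 1"
  by (cases "k \<in> J") (auto simp: cube_def PiE_dflt_def)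

lemma cube_abs: "x \<in> cube J \<Longrightarrow> \<bar>x k\<bar> = 1"
  using cube_cases[of x J k] by auto

lemma cube_square: "x \<in> cube J \<Longrightarrow> x k * x k = 1"
  using cube_cases[of x J k] by auto

lemma flip_cube: "x \<in> cube J \<Longrightarrow> k \<in> J \<Longrightarrow> flip k x \<in> cube J"
  by (auto simp: cube_def PiE_dflt_def flip_def)

lemma finite_cube: "finite J \<Longrightarrow> finite (cube J)"
  unfolding cube_def by (rule finite_PiE_dflt) auto

lemma card_cube: "finite J \<Longrightarrow> card (cube J) = 2 ^ card J"
  unfolding cube_def by (subst card_PiE_dflt) (auto simp: numeral_2_eq_2)

section \<open>Uniform averages over the cube and integration by parts\<close>

lemma avg_cong: "(\<And>x. x \<in> cube J \<Longrightarrow> \<phi> x = \<psi> x) \<Longrightarrow> avg J \<phi> = avg J \<psi>"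
  unfolding avg_def by (auto intro!: arg_cong2[of _ _ _ _ "(/)"] sum.cong)

lemma avg_mono: "(\<And>x. x \<in> cube J \<Longrightarrow> \<phi> x \<le> \<psi> x) \<Longrightarrow> avg J \<phi> \<le> avg J \<psi>"
  unfolding avg_def by (intro divide_right_mono sum_mono) auto

lemma avg_nonneg: "(\<And>x. x \<in> cube J \<Longrightarrow> 0 \<le> \<phi> x) \<Longrightarrow> 0 \<le> avg J \<phi>"
  unfolding avg_def by (intro divide_nonneg_nonneg sum_nonneg) auto

lemma avg_abs_le: "\<bar>avg J \<phi>\<bar> \<le> avg J (\<lambda>x. \<bar>\<phi> x\<bar>)"
  unfolding avg_def by (simp add: divide_right_mono sum_abs)

lemma avg_add: "avg J (\<lambda>x. \<phi> x + \<psi> x) = avg J \<phi> + avg J \<psi>"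
  by (simp add: avg_def sum.distrib add_divide_distrib)

lemma avg_diff: "avg J (\<lambda>x. \<phi> x - \<psi> x) = avg J \<phi> - avg J \<psi>"
  by (simp add: avg_def sum_subtractf diff_divide_distrib)

lemma avg_cmult: "avg J (\<lambda>x. c * \<phi> x) = c * avg J \<phi>"
  by (simp add: avg_def sum_distrib_left)

lemma avg_sum: "avg J (\<lambda>x. \<Sum>k\<in>K. \<phi> k x) = (\<Sum>k\<in>K. avg J (\<phi> k))"
  unfolding avg_def by (subst sum.swap) (simp add: sum_divide_distrib)

lemma avg_const: "finite J \<Longrightarrow> avg J (\<lambda>_. c) = c"
  by (simp add: avg_def card_cube)

lemma avg_flip:
  assumes "k \<in> J"
  shows "avg J (\<lambda>x. \<phi> (flip k x)) = avg J \<phi>"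
  unfolding avg_def
  by (rule arg_cong2[of _ _ _ _ "(/)"], rule sum.reindex_bij_witness[of _ "flip k" "flip k"])
     (use assms in \<open>auto intro: flip_cube\<close>)

text \<open>Independence of \<open>y\<close> from the sign at \<open>k\<close> is expressed as
  invariance under \<open>flip k\<close>. Averaging the integrand with its flipped image changes the
  sign of \<open>x k\<close> only and leaves the discrete derivative of
  \<open>\<psi>\<close>.\<close>

lemma avg_by_parts:
  assumes "k \<in> J" and y: "\<And>x. y (flip k x) = y x"
  shows "avg J (\<lambda>x. x k * y x * \<psi> x) = avg J (\<lambda>x. y x * (x k * (\<psi> x - \<psi> (flip k x)) / 2))"
proof -
  have "avg J (\<lambda>x. x k * y x * \<psi> x) = avg J (\<lambda>x. - (x k * y x * \<psi> (flip k x)))"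
    by (subst avg_flip[OF assms(1), symmetric]) (simp add: y)
  then have "avg J (\<lambda>x. x k * y x * \<psi> x)
      = (1/2) * (avg J (\<lambda>x. x k * y x * \<psi> x) + avg J (\<lambda>x. - (x k * y x * \<psi> (flip k x))))" by simp
  also have "\<dots> = avg J (\<lambda>x. (1/2) * (x k * y x * \<psi> x + - (x k * y x * \<psi> (flip k x))))"
    by (simp only: avg_cmult avg_add)
  also have "\<dots> = avg J (\<lambda>x. y x * (x k * (\<psi> x - \<psi> (flip k x)) / 2))"
    by (rule avg_cong) (simp add: field_simps)
  finally show ?thesis .
qed

lemma avg_Cauchy_Schwarz: "(avg J (\<lambda>x. \<phi> x * \<psi> x))\<^sup>2 \<le> avg J (\<lambda>x. (\<phi> x)\<^sup>2) * avg J (\<lambda>x. (\<psi> x)\<^sup>2)"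
proof -
  have "(\<Sum>x\<in>cube J. \<phi> x * \<psi> x)\<^sup>2 / (real (card (cube J)))\<^sup>2
      \<le> ((\<Sum>x\<in>cube J. (\<phi> x)\<^sup>2) * (\<Sum>x\<in>cube J. (\<psi> x)\<^sup>2)) / (real (card (cube J)))\<^sup>2"
    by (intro divide_right_mono Cauchy_Schwarz_ineq_sum) auto
  then show ?thesis
    by (simp add: avg_def power_divide power2_eq_square)
qed

lemma abs_one_minus_exp_minus: "\<bar>s\<bar> \<le> c \<Longrightarrow> \<bar>1 - exp (- s)\<bar> \<le> \<bar>s\<bar> * exp c" for s :: real
proof -
  assume s: "\<bar>s\<bar> \<le> c"
  obtain t where "\<bar>t\<bar> \<le> \<bar>- s\<bar>" "exp (- s) = (\<Sum>m<1. (- s) ^ m / fact m) + exp t / fact 1 * (- s) ^ 1"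
    using Maclaurin_exp_le[of "- s" 1] by blast
  then have t: "t \<le> c" "1 - exp (- s) = s * exp t" using s by (auto simp: mult.commute)
  then show ?thesis unfolding t(2) abs_mult using t(1) by (intro mult_mono) auto
qed

lemma abs_exp_minus_second_order: "\<bar>s\<bar> \<le> c \<Longrightarrow> \<bar>1 - exp (- s) - s\<bar> \<le> s\<^sup>2 / 2 * exp c" for s :: real
proof -
  assume s: "\<bar>s\<bar> \<le> c"
  obtain t where "\<bar>t\<bar> \<le> \<bar>- s\<bar>" "exp (- s) = (\<Sum>m<2. (- s) ^ m / fact m) + exp t / fact 2 * (- s) ^ 2"
    using Maclaurin_exp_le[of "- s" 2] by blast
  then have t: "t \<le> c" "1 - exp (- s) - s = - (s\<^sup>2 / 2 * exp t)" using s
    by (auto simp: eval_nat_numeral)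
  then show ?thesis unfolding t(2) abs_mult abs_minus using t(1) by (intro mult_mono) auto
qed

lemma five_power4: "(p + q + r + s + t) ^ 4 \<le> 125 * (p ^ 4 + q ^ 4 + r ^ 4 + s ^ 4 + t ^ 4)"
  and five_power2: "(p + q + r + s + t)\<^sup>2 \<le> 5 * (p\<^sup>2 + q\<^sup>2 + r\<^sup>2 + s\<^sup>2 + t\<^sup>2)" for p q r s t :: real
proof -
  have sq: "(p + q + r + s + t)\<^sup>2 \<le> 5 * (p\<^sup>2 + q\<^sup>2 + r\<^sup>2 + s\<^sup>2 + t\<^sup>2)" for p q r s t :: real
  proof -
    have "5 * (p\<^sup>2 + q\<^sup>2 + r\<^sup>2 + s\<^sup>2 + t\<^sup>2) - (p + q + r + s + t)\<^sup>2
      = (p - q)\<^sup>2 + (p - r)\<^sup>2 + (p - s)\<^sup>2 + (p - t)\<^sup>2 + (q - r)\<^sup>2 + (q - s)\<^sup>2 + (q - t)\<^sup>2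
        + (r - s)\<^sup>2 + (r - t)\<^sup>2 + (s - t)\<^sup>2"
      by (simp add: power2_eq_square algebra_simps)
    also have "\<dots> \<ge> 0" by simp
    finally show ?thesis by simp
  qed
  show "(p + q + r + s + t)\<^sup>2 \<le> 5 * (p\<^sup>2 + q\<^sup>2 + r\<^sup>2 + s\<^sup>2 + t\<^sup>2)" by (rule sq)
  have "(p + q + r + s + t) ^ 4 = ((p + q + r + s + t)\<^sup>2)\<^sup>2" by simp
  also have "\<dots> \<le> (5 * (p\<^sup>2 + q\<^sup>2 + r\<^sup>2 + s\<^sup>2 + t\<^sup>2))\<^sup>2" by (intro power_mono sq) auto
  also have "\<dots> = 25 * (p\<^sup>2 + q\<^sup>2 + r\<^sup>2 + s\<^sup>2 + t\<^sup>2)\<^sup>2" by (subst power_mult_distrib) simp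
  also have "\<dots> \<le> 25 * (5 * ((p\<^sup>2)\<^sup>2 + (q\<^sup>2)\<^sup>2 + (r\<^sup>2)\<^sup>2 + (s\<^sup>2)\<^sup>2 + (t\<^sup>2)\<^sup>2))"
    by (intro mult_left_mono sq) auto
  finally show "(p + q + r + s + t) ^ 4 \<le> 125 * (p ^ 4 + q ^ 4 + r ^ 4 + s ^ 4 + t ^ 4)" by simp
qed

section \<open>The centred sum, its discrete derivatives and its variance\<close>

locale chain =
  fixes b :: "int \<Rightarrow> real" and N :: int
  assumes supp: "\<bar>k\<bar> > N \<Longrightarrow> b k = 0"
begin

text \<open>The margin 4 is 2 + 2: local expressions in \<open>b\<close> are nonzero only within
  distance 2 of the support, and \<open>sum_shift\<close> moves indices by up to 2.\<close>

definition J :: "int set" where "J = {- N - 4..N + 4}"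

text \<open>The mean 1/4 of a product of two neighbouring indicators is subtracted termwise. The sum
  is centred but not scaled; unit variance is imposed in \<open>unit_chain\<close>.\<close>

definition F :: "(int \<Rightarrow> real) \<Rightarrow> real" where
  "F x = (\<Sum>k\<in>J. b k * ((x k + 1) / 2 * ((x (k + 1) + 1) / 2) - 1 / 4))"

text \<open>The coefficient of \<open>x k\<close> in the linear part of \<open>F\<close>, collected
  from the two products that contain \<open>x k\<close>.\<close>

definition c :: "int \<Rightarrow> real" where "c k = (b k + b (k - 1)) / 4"

text \<open>In the notation of the discrete Malliavin calculus \<open>d k = D\<^sub>k F\<close> and \<open>u k = - D\<^sub>k L\<^sup>-\<^sup>1 F\<close>.\<close>

definition d :: "int \<Rightarrow> (int \<Rightarrow> real) \<Rightarrow> real" where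
  "d k x = c k + (b k * x (k + 1) + b (k - 1) * x (k - 1)) / 4"

definition u :: "int \<Rightarrow> (int \<Rightarrow> real) \<Rightarrow> real" where
  "u k x = c k + (b k * x (k + 1) + b (k - 1) * x (k - 1)) / 8"

text \<open>The sum of the squared coefficients of \<open>F\<close> with respect to the orthonormal
  sign products: \<open>c k\<close> belongs to x k, and \<open>b k / 4\<close> to x k x (k +
  1).\<close>

definition var :: real where "var = (\<Sum>k\<in>J. (c k)\<^sup>2 + (b k)\<^sup>2 / 16)"

definition A :: "(int \<Rightarrow> real) \<Rightarrow> real" where
  "A x = var - (\<Sum>k\<in>J. u k x * d k x)"

definition B :: "(int \<Rightarrow> real) \<Rightarrow> real" where
  "B x = (\<Sum>k\<in>J. x k * (\<bar>u k x\<bar> * d k x))"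

text \<open>Chosen so that \<open>A\<close> is the sum of x k times \<open>yA k\<close>, with
  \<open>yA k\<close> free of x k, as integration by parts requires. Linear terms of u d are moved
  to their own site (3/8 is 1/4 + 1/8), and a product x (k - 1) x (k + 1) is assigned to its left
  site.\<close>

definition yA :: "int \<Rightarrow> (int \<Rightarrow> real) \<Rightarrow> real" where
  "yA k x = - (3 / 8) * (c (k - 1) * b (k - 1) + c (k + 1) * b k) - b (k + 1) * b k * x (k + 2) / 16"

definition C :: real where "C = sqrt (\<Sum>k\<in>J. b k ^ 4)"

text \<open>One local scale for all estimates at site \<open>k\<close>: it bounds |u k| and |d k|,
  its square bounds |yA k|, and twice its square bounds the effect of a flip at \<open>k\<close> on
  \<open>A\<close> and \<open>B\<close>.\<close>

definition mu :: "int \<Rightarrow> real" where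
  "mu k = \<bar>b (k - 2)\<bar> + \<bar>b (k - 1)\<bar> + \<bar>b k\<bar> + \<bar>b (k + 1)\<bar> + \<bar>b (k + 2)\<bar>"

lemma finite_J [simp, intro]: "finite J" by (simp add: J_def)

lemma sum_shift:
  fixes g :: "int \<Rightarrow> real"
  assumes "\<bar>j\<bar> \<le> 2" and g: "\<And>k. \<bar>k\<bar> > N + 2 \<Longrightarrow> g k = 0"
  shows "(\<Sum>k\<in>J. g (k + j)) = (\<Sum>k\<in>J. g k)"
proof -
  have "(\<Sum>k\<in>J. g (k + j)) = (\<Sum>k\<in>(\<lambda>k. k + j) ` J. g k)"
    by (subst sum.reindex) (auto simp: inj_on_def)
  also have "(\<lambda>k. k + j) ` J = {- N - 4 + j..N + 4 + j}" by (simp add: J_def)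
  also have "(\<Sum>k\<in>{- N - 4 + j..N + 4 + j}. g k) = (\<Sum>k\<in>{- N - 2..N + 2}. g k)"
    using assms by (intro sum.mono_neutral_right) (auto intro!: g)
  also have "\<dots> = (\<Sum>k\<in>J. g k)"
    by (intro sum.mono_neutral_left) (auto simp: J_def intro!: g)
  finally show ?thesis .
qed

text \<open>Each quadratic term is divided equally between its two sites, which is why
  \<open>u\<close> has 1/8 where \<open>d\<close> has 1/4. This halving is the action of the inverse
  generator on the second chaos.\<close>

lemma F_eq: "F x = (\<Sum>k\<in>J. x k * u k x)"
proof -
  have s1: "(\<Sum>k\<in>J. b k * x (k + 1)) = (\<Sum>k\<in>J. b (k - 1) * x k)"
    using sum_shift[of 1 "\<lambda>k. b (k - 1) * x k"] by (simp add: supp)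
  have s2: "(\<Sum>k\<in>J. b k * x k * x (k + 1)) = (\<Sum>k\<in>J. b (k - 1) * x (k - 1) * x k)"
    using sum_shift[of 1 "\<lambda>k. b (k - 1) * x (k - 1) * x k"] by (simp add: supp)
  have "F x = (\<Sum>k\<in>J. b k * x k) / 4 + (\<Sum>k\<in>J. b k * x (k + 1)) / 4 + (\<Sum>k\<in>J. b k * x k * x (k + 1)) / 8
     + (\<Sum>k\<in>J. b k * x k * x (k + 1)) / 8"
    unfolding F_def sum_divide_distrib sum.distrib[symmetric]
    by (rule sum.cong) (auto simp: field_simps)
  also have "\<dots> = (\<Sum>k\<in>J. b k * x k) / 4 + (\<Sum>k\<in>J. b (k - 1) * x k) / 4 + (\<Sum>k\<in>J. b k * x k * x (k + 1)) / 8
     + (\<Sum>k\<in>J. b (k - 1) * x (k - 1) * x k) / 8"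
    by (simp only: s1) (simp only: s2)
  also have "\<dots> = (\<Sum>k\<in>J. x k * u k x)"
    unfolding u_def c_def sum_divide_distrib sum.distrib[symmetric]
    by (rule sum.cong) (auto simp: field_simps)
  finally show ?thesis .
qed

text \<open>\<open>F\<close> is affine in each coordinate, so there is no remainder. Only the
  summands \<open>k - 1\<close> and \<open>k\<close> contain x k; if one of these indices lies
  outside \<open>J\<close>, its coefficient vanishes.\<close>

lemma F_flip:
  assumes "k \<in> J"
  shows "F (flip k x) = F x - 2 * x k * d k x"
proof -
  define g where "g x j = b j * ((x j + 1) / 2 * ((x (j + 1) + 1) / 2) - 1 / 4)" for x j
  have "F x - F (flip k x) = (\<Sum>j\<in>J. g x j - g (flip k x) j)"
    by (simp add: F_def g_def sum_subtractf)
  also have "\<dots> = (\<Sum>j\<in>{k - 1, k}. g x j - g (flip k x) j)"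
  proof (rule sum.mono_neutral_cong)
    fix i assume "i \<in> {k - 1, k} - J"
    then have "\<bar>i\<bar> > N" by (auto simp: J_def)
    then show "g x i - g (flip k x) i = 0" by (simp add: g_def supp)
  next
    fix i assume "i \<in> J - {k - 1, k}"
    then have "i \<noteq> k" "i + 1 \<noteq> k" by auto
    then show "g x i - g (flip k x) i = 0" by (simp add: g_def)
  qed auto
  also have "\<dots> = 2 * x k * d k x"
    by (simp add: g_def d_def c_def field_simps)
  finally show ?thesis by simp
qed

lemma u_flip: "u k (flip k x) = u k x" by (simp add: u_def)
lemma d_flip: "d k (flip k x) = d k x" by (simp add: d_def)
lemma yA_flip: "yA k (flip k x) = yA k x" by (simp add: yA_def)

text \<open>On the cube the squares of signs are 1, so the diagonal terms of u d add up to exactly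
  \<open>var\<close> and cancel. The remaining terms are regrouped by index shifts.\<close>

lemma A_eq:
  assumes x: "x \<in> cube J"
  shows "A x = (\<Sum>k\<in>J. x k * yA k x)"
proof -
  have s1: "(\<Sum>k\<in>J. c k * b k * x (k + 1)) = (\<Sum>k\<in>J. c (k - 1) * b (k - 1) * x k)"
    using sum_shift[of 1 "\<lambda>k. c (k - 1) * b (k - 1) * x k"] by (simp add: supp)
  have s2: "(\<Sum>k\<in>J. c k * b (k - 1) * x (k - 1)) = (\<Sum>k\<in>J. c (k + 1) * b k * x k)"
    using sum_shift[of "-1" "\<lambda>k. c (k + 1) * b k * x k"] by (simp add: supp)
  have s3: "(\<Sum>k\<in>J. b k * b (k - 1) * x (k + 1) * x (k - 1)) = (\<Sum>k\<in>J. b (k + 1) * b k * x (k + 2) * x k)"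
    using sum_shift[of "-1" "\<lambda>k. b (k + 1) * b k * x (k + 2) * x k"] by (simp add: supp add.commute)
  have s4: "(\<Sum>k\<in>J. (b (k - 1))\<^sup>2) = (\<Sum>k\<in>J. (b k)\<^sup>2)"
    using sum_shift[of "-1" "\<lambda>k. (b k)\<^sup>2"] by (simp add: supp)
  have ud: "u k x * d k x = (c k)\<^sup>2 + 3 / 8 * (c k * b k * x (k + 1)) + 3 / 8 * (c k * b (k - 1) * x (k - 1))
     + (b k)\<^sup>2 / 32 + (b (k - 1))\<^sup>2 / 32 + b k * b (k - 1) * x (k + 1) * x (k - 1) / 16" for k
  proof -
    have "u k x * d k x = (c k)\<^sup>2 + 3 / 8 * (c k * b k * x (k + 1)) + 3 / 8 * (c k * b (k - 1) * x (k - 1))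
     + (b k)\<^sup>2 * (x (k + 1) * x (k + 1)) / 32 + (b (k - 1))\<^sup>2 * (x (k - 1) * x (k - 1)) / 32
     + b k * b (k - 1) * x (k + 1) * x (k - 1) / 16"
      by (simp add: u_def d_def field_simps power2_eq_square)
    then show ?thesis by (simp only: cube_square[OF x] mult_1_right)
  qed
  have "(\<Sum>k\<in>J. u k x * d k x) = (\<Sum>k\<in>J. (c k)\<^sup>2) + 3 / 8 * (\<Sum>k\<in>J. c k * b k * x (k + 1))
     + 3 / 8 * (\<Sum>k\<in>J. c k * b (k - 1) * x (k - 1)) + (\<Sum>k\<in>J. (b k)\<^sup>2) / 32 + (\<Sum>k\<in>J. (b (k - 1))\<^sup>2) / 32
     + (\<Sum>k\<in>J. b k * b (k - 1) * x (k + 1) * x (k - 1)) / 16"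
    unfolding ud by (simp add: sum.distrib sum_distrib_left sum_divide_distrib)
  also have "\<dots> = (\<Sum>k\<in>J. (c k)\<^sup>2) + 3 / 8 * (\<Sum>k\<in>J. c (k - 1) * b (k - 1) * x k)
     + 3 / 8 * (\<Sum>k\<in>J. c (k + 1) * b k * x k) + (\<Sum>k\<in>J. (b k)\<^sup>2) / 16
     + (\<Sum>k\<in>J. b (k + 1) * b k * x (k + 2) * x k) / 16"
    by (simp add: s1 s2 s3 s4)
  also have "\<dots> = var - (\<Sum>k\<in>J. x k * yA k x)"
    unfolding var_def yA_def
    by (simp add: sum.distrib sum_distrib_left sum_divide_distrib algebra_simps sum_negf sum_subtractf)
  finally show ?thesis unfolding A_def by simp
qed

lemma avg_F_times:
  "avg J (\<lambda>x. F x * g x) = (\<Sum>k\<in>J. avg J (\<lambda>x. u k x * (x k * (g x - g (flip k x)) / 2)))"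
proof -
  have "avg J (\<lambda>x. F x * g x) = avg J (\<lambda>x. \<Sum>k\<in>J. x k * u k x * g x)"
    by (simp add: F_eq sum_distrib_right)
  also have "\<dots> = (\<Sum>k\<in>J. avg J (\<lambda>x. x k * u k x * g x))" by (rule avg_sum)
  also have "\<dots> = (\<Sum>k\<in>J. avg J (\<lambda>x. u k x * (x k * (g x - g (flip k x)) / 2)))"
    by (intro sum.cong refl avg_by_parts) (simp_all add: u_flip)
  finally show ?thesis .
qed

lemma avg_F: "avg J F = 0"
  using avg_F_times[of "\<lambda>_. 1"] avg_const[of J 0] by simp

lemma avg_A: "avg J A = 0"
proof -
  have "avg J A = (\<Sum>k\<in>J. avg J (\<lambda>x. x k * yA k x * 1))"
    unfolding avg_sum[symmetric] by (rule avg_cong) (simp add: A_eq)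
  also have "\<dots> = (\<Sum>k\<in>J. avg J (\<lambda>x. yA k x * (x k * (1 - 1) / 2)))"
    by (intro sum.cong refl avg_by_parts) (simp_all add: yA_flip)
  finally show ?thesis using avg_const[of J 0] by simp
qed

text \<open>Integration by parts against \<open>F\<close> itself turns the second moment into the
  average of \<open>var - A\<close>, and \<open>A\<close> is centred.\<close>

lemma avg_F_square: "avg J (\<lambda>x. (F x)\<^sup>2) = var"
proof -
  have "avg J (\<lambda>x. (F x)\<^sup>2) = (\<Sum>k\<in>J. avg J (\<lambda>x. u k x * (x k * (F x - F (flip k x)) / 2)))"
    using avg_F_times[of F] by (simp add: power2_eq_square)
  also have "\<dots> = (\<Sum>k\<in>J. avg J (\<lambda>x. u k x * d k x))"
    by (intro sum.cong refl avg_cong) (simp add: F_flip cube_square mult.assoc[symmetric])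
  also have "\<dots> = avg J (\<lambda>x. var - A x)"
    unfolding avg_sum[symmetric] by (rule avg_cong) (simp add: A_def)
  also have "\<dots> = var" by (simp add: avg_diff avg_A avg_const)
  finally show ?thesis .
qed

section \<open>Local size bounds and their sums\<close>

lemma C_nonneg: "C \<ge> 0" unfolding C_def by (intro real_sqrt_ge_zero sum_nonneg) auto

lemma C_square: "C\<^sup>2 = (\<Sum>k\<in>J. b k ^ 4)"
  unfolding C_def by (simp add: sum_nonneg)

lemma b_square_le_C: "(b k)\<^sup>2 \<le> C"
proof -
  have "b k ^ 4 \<le> C\<^sup>2"
  proof (cases "k \<in> J")
    case True then show ?thesis unfolding C_square by (intro member_le_sum) auto
  next
    case False
    then have "b k = 0" by (intro supp) (auto simp: J_def)
    then show ?thesis by simp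
  qed
  then have "((b k)\<^sup>2)\<^sup>2 \<le> C\<^sup>2" by simp
  then show ?thesis using C_nonneg by (rule power2_le_imp_le)
qed

lemma mu_nonneg: "mu k \<ge> 0" by (simp add: mu_def)

lemma abs_c_le: "\<bar>c k\<bar> \<le> (\<bar>b k\<bar> + \<bar>b (k - 1)\<bar>) / 4"
  by (simp add: c_def)

lemma abs_e_le:
  assumes "x \<in> cube J"
  shows "\<bar>b k * x (k + 1) + b (k - 1) * x (k - 1)\<bar> \<le> \<bar>b k\<bar> + \<bar>b (k - 1)\<bar>"
proof -
  have "\<bar>b k * x (k + 1)\<bar> = \<bar>b k\<bar>" "\<bar>b (k - 1) * x (k - 1)\<bar> = \<bar>b (k - 1)\<bar>"
    by (simp_all add: abs_mult cube_abs[OF assms])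
  then show ?thesis by linarith
qed

lemma abs_d_le:
  assumes "x \<in> cube J"
  shows "\<bar>d k x\<bar> \<le> (\<bar>b k\<bar> + \<bar>b (k - 1)\<bar>) / 2"
  unfolding d_def using abs_c_le[of k] abs_e_le[OF assms, of k] unfolding abs_le_iff by (simp add: field_simps)

lemma abs_u_le:
  assumes "x \<in> cube J"
  shows "\<bar>u k x\<bar> \<le> (\<bar>b k\<bar> + \<bar>b (k - 1)\<bar>) / 2"
  unfolding u_def using abs_c_le[of k] abs_e_le[OF assms, of k] unfolding abs_le_iff by (simp add: field_simps)

lemma abs_d_le_mu: "x \<in> cube J \<Longrightarrow> \<bar>d k x\<bar> \<le> mu k"
  using abs_d_le[of x k] by (simp add: mu_def)

lemma abs_u_le_mu: "x \<in> cube J \<Longrightarrow> \<bar>u k x\<bar> \<le> mu k"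
  using abs_u_le[of x k] by (simp add: mu_def)

lemma abs_ud_le:
  assumes "x \<in> cube J"
  shows "\<bar>u k x * d k x\<bar> \<le> (\<bar>b k\<bar> + \<bar>b (k - 1)\<bar>)\<^sup>2 / 4"
proof -
  have "\<bar>u k x * d k x\<bar> \<le> ((\<bar>b k\<bar> + \<bar>b (k - 1)\<bar>) / 2) * ((\<bar>b k\<bar> + \<bar>b (k - 1)\<bar>) / 2)"
    unfolding abs_mult by (intro mult_mono abs_u_le abs_d_le assms) auto
  then show ?thesis by (simp add: power2_eq_square)
qed

lemma abs_yA_le:
  assumes "x \<in> cube J"
  shows "\<bar>yA k x\<bar> \<le> (mu k)\<^sup>2"
proof -
  have 1: "\<bar>c (k - 1) * b (k - 1)\<bar> \<le> mu k * mu k" "\<bar>c (k + 1) * b k\<bar> \<le> mu k * mu k"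
    unfolding abs_mult
    by (intro mult_mono order.trans[OF abs_c_le]; simp add: mu_def)+
  have 2: "\<bar>b (k + 1) * b k * x (k + 2)\<bar> \<le> mu k * mu k"
    unfolding abs_mult cube_abs[OF assms] mult_1_right by (intro mult_mono) (simp_all add: mu_def)
  have "\<bar>yA k x\<bar> \<le> 3 / 8 * (\<bar>c (k - 1) * b (k - 1)\<bar> + \<bar>c (k + 1) * b k\<bar>) + \<bar>b (k + 1) * b k * x (k + 2)\<bar> / 16"
  proof -
    have "\<bar>- (3 / 8) * (p + q) - r / 16\<bar> \<le> 3 / 8 * (\<bar>p\<bar> + \<bar>q\<bar>) + \<bar>r\<bar> / 16" for p q r :: real
      by (auto simp: abs_if field_simps)
    then show ?thesis unfolding yA_def .
  qed
  also have "\<dots> \<le> mu k * mu k" using 1 2 mu_nonneg[of k] by (simp add: field_simps)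
  finally show ?thesis by (simp add: power2_eq_square)
qed

text \<open>A flip at \<open>k\<close> affects only the summands at three sites, each bounded by a
  quarter of the squared scale before and after the flip. Stated for general \<open>h\<close> so as
  to serve both \<open>A\<close> and \<open>B\<close>.\<close>

lemma local_sum_flip_le:
  assumes "k \<in> J" "x \<in> cube J"
    and inv: "\<And>i. \<bar>i - k\<bar> > 1 \<Longrightarrow> h i (flip k x) = h i x"
    and bd: "\<And>i x. x \<in> cube J \<Longrightarrow> \<bar>h i x\<bar> \<le> (\<bar>b i\<bar> + \<bar>b (i - 1)\<bar>)\<^sup>2 / 4"
  shows "\<bar>(\<Sum>i\<in>J. h i x) - (\<Sum>i\<in>J. h i (flip k x))\<bar> \<le> 2 * (mu k)\<^sup>2"
proof -
  have fx: "flip k x \<in> cube J" using assms by (intro flip_cube)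
  have zero: "h i y = 0" if "i \<notin> J" "y \<in> cube J" for i y
  proof -
    have "b i = 0" "b (i - 1) = 0" using that(1) by (auto simp: J_def intro!: supp)
    then show ?thesis using bd[OF that(2), of i] by simp
  qed
  have "(\<Sum>i\<in>J. h i x) - (\<Sum>i\<in>J. h i (flip k x)) = (\<Sum>i\<in>J. h i x - h i (flip k x))"
    by (simp add: sum_subtractf)
  also have "\<dots> = (\<Sum>i\<in>{k - 1, k, k + 1}. h i x - h i (flip k x))"
    by (rule sum.mono_neutral_cong) (auto simp: zero assms fx intro!: inv)
  finally have "\<bar>(\<Sum>i\<in>J. h i x) - (\<Sum>i\<in>J. h i (flip k x))\<bar>
     \<le> (\<Sum>i\<in>{k - 1, k, k + 1}. \<bar>h i x\<bar> + \<bar>h i (flip k x)\<bar>)"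
    by (simp only:) (rule order.trans[OF sum_abs sum_mono], rule abs_triangle_ineq4)
  also have "\<dots> \<le> (\<Sum>i\<in>{k - 1, k, k + 1}. (mu k)\<^sup>2 / 4 + (mu k)\<^sup>2 / 4)"
  proof (intro sum_mono add_mono)
    fix i assume i: "i \<in> {k - 1, k, k + 1}"
    have "(\<bar>b i\<bar> + \<bar>b (i - 1)\<bar>)\<^sup>2 \<le> (mu k)\<^sup>2"
      using i by (intro power_mono) (auto simp: mu_def)
    then have *: "(\<bar>b i\<bar> + \<bar>b (i - 1)\<bar>)\<^sup>2 / 4 \<le> (mu k)\<^sup>2 / 4" by simp
    show "\<bar>h i x\<bar> \<le> (mu k)\<^sup>2 / 4" using bd[OF assms(2)] * by (rule order.trans)
    show "\<bar>h i (flip k x)\<bar> \<le> (mu k)\<^sup>2 / 4" using bd[OF fx] * by (rule order.trans)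
  qed
  also have "\<dots> \<le> 2 * (mu k)\<^sup>2" by simp
  finally show ?thesis .
qed

lemma A_flip_le:
  assumes "k \<in> J" "x \<in> cube J" shows "\<bar>A x - A (flip k x)\<bar> \<le> 2 * (mu k)\<^sup>2"
proof -
  have "\<bar>(\<Sum>i\<in>J. u i x * d i x) - (\<Sum>i\<in>J. u i (flip k x) * d i (flip k x))\<bar> \<le> 2 * (mu k)\<^sup>2"
  proof (rule local_sum_flip_le[OF assms])
    show "\<bar>i - k\<bar> > 1 \<Longrightarrow> u i (flip k x) * d i (flip k x) = u i x * d i x" for i
      by (auto simp: u_def d_def)
  qed (rule abs_ud_le)
  then show ?thesis unfolding A_def by linarith
qed

lemma B_flip_le:
  assumes "k \<in> J" "x \<in> cube J" shows "\<bar>B x - B (flip k x)\<bar> \<le> 2 * (mu k)\<^sup>2"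
  unfolding B_def
proof (rule local_sum_flip_le[OF assms])
  show "\<bar>i - k\<bar> > 1 \<Longrightarrow> flip k x i * (\<bar>u i (flip k x)\<bar> * d i (flip k x)) = x i * (\<bar>u i x\<bar> * d i x)" for i
    by (auto simp: u_def d_def)
  show "\<bar>x i * (\<bar>u i x\<bar> * d i x)\<bar> \<le> (\<bar>b i\<bar> + \<bar>b (i - 1)\<bar>)\<^sup>2 / 4" if "x \<in> cube J" for i x
    using abs_ud_le[OF that, of i] by (simp add: abs_mult cube_abs[OF that])
qed

lemma sum_power_shift:
  assumes "n > 0" "\<bar>j\<bar> \<le> 2" shows "(\<Sum>k\<in>J. b (k + j) ^ n) = (\<Sum>k\<in>J. b k ^ n)"
  using sum_shift[of j "\<lambda>k. b k ^ n"] assms by (simp add: supp)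

lemma sum_mu4: "(\<Sum>k\<in>J. mu k ^ 4) \<le> 625 * C\<^sup>2"
proof -
  have "(\<Sum>k\<in>J. mu k ^ 4) \<le> (\<Sum>k\<in>J. 125 * (b (k + - 2) ^ 4 + b (k + - 1) ^ 4 + b k ^ 4 + b (k + 1) ^ 4 + b (k + 2) ^ 4))"
  proof (rule sum_mono)
    fix k
    show "mu k ^ 4 \<le> 125 * (b (k + - 2) ^ 4 + b (k + - 1) ^ 4 + b k ^ 4 + b (k + 1) ^ 4 + b (k + 2) ^ 4)"
      using five_power4[of "\<bar>b (k - 2)\<bar>" "\<bar>b (k - 1)\<bar>" "\<bar>b k\<bar>" "\<bar>b (k + 1)\<bar>" "\<bar>b (k + 2)\<bar>"]
      by (simp add: mu_def)
  qed
  also have "\<dots> = 625 * C\<^sup>2"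
    unfolding sum_distrib_left[symmetric] sum.distrib C_square by (subst sum_power_shift, simp, simp)+ simp
  finally show ?thesis .
qed

text \<open>The term \<open>(b k)^2 / 16\<close> in \<open>var\<close> carries this bound: the
  linear coefficients \<open>c k\<close> may vanish by cancellation between neighbours, the
  quadratic ones cannot. The constant is 25 * 16.\<close>

lemma sum_mu2: "(\<Sum>k\<in>J. (mu k)\<^sup>2) \<le> 400 * var"
proof -
  have "(\<Sum>k\<in>J. (mu k)\<^sup>2) \<le> (\<Sum>k\<in>J. 5 * ((b (k + - 2))\<^sup>2 + (b (k + - 1))\<^sup>2 + (b k)\<^sup>2 + (b (k + 1))\<^sup>2 + (b (k + 2))\<^sup>2))"
  proof (rule sum_mono)
    fix k
    show "(mu k)\<^sup>2 \<le> 5 * ((b (k + - 2))\<^sup>2 + (b (k + - 1))\<^sup>2 + (b k)\<^sup>2 + (b (k + 1))\<^sup>2 + (b (k + 2))\<^sup>2)"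
      using five_power2[of "\<bar>b (k - 2)\<bar>" "\<bar>b (k - 1)\<bar>" "\<bar>b k\<bar>" "\<bar>b (k + 1)\<bar>" "\<bar>b (k + 2)\<bar>"]
      by (simp add: mu_def)
  qed
  also have "\<dots> = 25 * (\<Sum>k\<in>J. (b k)\<^sup>2)"
    unfolding sum_distrib_left[symmetric] sum.distrib by (subst sum_power_shift, simp, simp)+ simp
  also have "(\<Sum>k\<in>J. (b k)\<^sup>2) \<le> 16 * var"
    unfolding var_def sum_distrib_left by (rule sum_mono) simp
  finally show ?thesis by simp
qed

end

section \<open>Exponential tilting and the tail of the normalised sum\<close>

text \<open>625 is the constant of \<open>sum_mu4\<close>, and exp 6 bounds the change of the
  tilting weight under one flip.\<close>

definition chain_const :: real where "chain_const = 625 * exp 6"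

lemma chain_const_pos: "chain_const > 0" by (simp add: chain_const_def)

locale unit_chain = chain +
  assumes var_1: "var = 1"
begin

definition mgf :: "real \<Rightarrow> real" where
  "mgf t = avg J (\<lambda>x. exp (t * F x))"

text \<open>The bound on t^3 C keeps the cubic error in the exponent of \<open>mgf\<close> bounded;
  together with C <= 2 it also bounds t |d k|. The value 16 is what tilts up to z + 1 require in
  \<open>avg_stein_majorant\<close>.\<close>

definition admissible :: "real \<Rightarrow> bool" where
  "admissible t \<longleftrightarrow> 0 \<le> t \<and> t ^ 3 * C \<le> 16 \<and> C \<le> 2"

lemma admissible_mono: "admissible t \<Longrightarrow> 0 \<le> s \<Longrightarrow> s \<le> t \<Longrightarrow> admissible s"
  unfolding admissible_def
  by (metis C_nonneg mult_right_mono order.trans power_mono)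

text \<open>Cauchy-Schwarz between the squares and the fourth powers; 500 is the square root of 400
  * 625. The normalisation \<open>var_1\<close> enters here.\<close>

lemma sum_mu3: "(\<Sum>k\<in>J. mu k ^ 3) \<le> 500 * C"
proof -
  have "(\<Sum>k\<in>J. mu k * (mu k)\<^sup>2)\<^sup>2 \<le> (\<Sum>k\<in>J. (mu k)\<^sup>2) * (\<Sum>k\<in>J. ((mu k)\<^sup>2)\<^sup>2)"
    by (rule Cauchy_Schwarz_ineq_sum)
  also have "\<dots> \<le> 400 * (625 * C\<^sup>2)"
    using sum_mu2 sum_mu4 by (intro mult_mono sum_nonneg) (auto simp: var_1)
  also have "\<dots> = (500 * C)\<^sup>2" by (simp add: power_mult_distrib)
  finally have "(\<Sum>k\<in>J. mu k * (mu k)\<^sup>2) \<le> 500 * C"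
    by (rule power2_le_imp_le) (simp add: C_nonneg)
  then show ?thesis by (simp add: power3_eq_cube power2_eq_square mult.assoc)
qed

lemma mgf_pos: "mgf t > 0"
proof -
  have "cube J \<noteq> {}"
    using card_cube[of J] by auto
  then show ?thesis
    unfolding mgf_def avg_def
    by (intro divide_pos_pos sum_pos) (auto simp: finite_cube card_gt_0_iff)
qed

text \<open>Since (d k)^2 <= C, the sixth power is at most (t^3 C)^2 C <= 512, which is below 3^6 =
  729.\<close>

lemma abs_td_le:
  assumes "admissible t" "x \<in> cube J"
  shows "t * \<bar>d k x\<bar> \<le> 3"
proof -
  have t: "0 \<le> t" "t ^ 3 * C \<le> 16" "C \<le> 2" using assms(1) by (auto simp: admissible_def)
  have "(d k x)\<^sup>2 \<le> ((\<bar>b k\<bar> + \<bar>b (k - 1)\<bar>) / 2)\<^sup>2"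
    using power_mono[OF abs_d_le[OF assms(2), of k], of 2] by simp
  also have "\<dots> \<le> ((b k)\<^sup>2 + (b (k - 1))\<^sup>2) / 2"
    using sum_squares_bound[of "\<bar>b k\<bar>" "\<bar>b (k - 1)\<bar>"] by (simp add: power2_eq_square field_simps)
  also have "\<dots> \<le> C" using b_square_le_C[of k] b_square_le_C[of "k - 1"] by simp
  finally have "((d k x)\<^sup>2) ^ 3 \<le> C ^ 3" by (intro power_mono) auto
  then have d6: "\<bar>d k x\<bar> ^ 6 \<le> C ^ 3" by (simp flip: power_mult)
  have "(t * \<bar>d k x\<bar>) ^ 6 = t ^ 6 * \<bar>d k x\<bar> ^ 6" by (simp add: power_mult_distrib)
  also have "\<dots> \<le> t ^ 6 * C ^ 3" using d6 t by (intro mult_left_mono) auto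
  also have "\<dots> = (t ^ 3 * C) * (t ^ 3 * C) * C" by (simp add: algebra_simps eval_nat_numeral)
  also have "\<dots> \<le> 16 * 16 * 2" using t C_nonneg by (intro mult_mono) auto
  also have "\<dots> \<le> (3::real) ^ 6" by simp
  finally show ?thesis by (rule power_le_imp_le_base[of _ 5, simplified]) simp_all
qed

text \<open>Because \<open>F_flip\<close> is exact, flipping multiplies the weight by exp (- s) with
  s = 2 t x k d k and |s| <= 6. All three claims reduce to scalar estimates of exp (- s).\<close>

lemma
  assumes t: "admissible t" and x: "x \<in> cube J" and k: "k \<in> J"
  shows exp_flip_le: "exp (t * F (flip k x)) \<le> exp 6 * exp (t * F x)"
    and exp_flip_diff: "\<bar>exp (t * F x) - exp (t * F (flip k x))\<bar> \<le> 2 * t * \<bar>d k x\<bar> * exp 6 * exp (t * F x)"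
    and exp_flip_taylor: "\<bar>x k * (exp (t * F x) - exp (t * F (flip k x))) / 2 - t * d k x * exp (t * F x)\<bar>
          \<le> t\<^sup>2 * (d k x)\<^sup>2 * exp 6 * exp (t * F x)"
proof -
  define s where "s = 2 * t * (x k * d k x)"
  have t0: "t \<ge> 0" using t by (simp add: admissible_def)
  have abs_s: "\<bar>s\<bar> = 2 * t * \<bar>d k x\<bar>" using t0 by (simp add: s_def abs_mult cube_abs[OF x])
  have s6: "\<bar>s\<bar> \<le> 6" using abs_td_le[OF t x, of k] abs_s by simp
  have e: "exp (t * F (flip k x)) = exp (- s) * exp (t * F x)"
    by (simp add: F_flip[OF k] s_def flip: exp_add) (simp add: algebra_simps)
  show "exp (t * F (flip k x)) \<le> exp 6 * exp (t * F x)"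
    unfolding e using s6 by (intro mult_right_mono) auto
  have "\<bar>exp (t * F x) - exp (t * F (flip k x))\<bar> = \<bar>1 - exp (- s)\<bar> * exp (t * F x)"
    unfolding e using abs_mult[of "1 - exp (- s)" "exp (t * F x)"] by (simp add: algebra_simps)
  also have "\<dots> \<le> (\<bar>s\<bar> * exp 6) * exp (t * F x)"
    by (intro mult_right_mono abs_one_minus_exp_minus s6) simp
  finally show "\<bar>exp (t * F x) - exp (t * F (flip k x))\<bar> \<le> 2 * t * \<bar>d k x\<bar> * exp 6 * exp (t * F x)"
    by (simp add: abs_s)
  have td: "t * d k x = x k * s / 2"
    using cube_square[OF x, of k] by (simp add: s_def algebra_simps)
  have "x k * (exp (t * F x) - exp (t * F (flip k x))) / 2 - t * d k x * exp (t * F x)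
      = x k / 2 * ((1 - exp (- s) - s) * exp (t * F x))"
    unfolding e td by (simp add: field_simps)
  then have "\<bar>x k * (exp (t * F x) - exp (t * F (flip k x))) / 2 - t * d k x * exp (t * F x)\<bar>
      = \<bar>1 - exp (- s) - s\<bar> * exp (t * F x) / 2"
    by (simp only: abs_mult abs_divide cube_abs[OF x] abs_exp_cancel)
  also have "\<dots> \<le> (s\<^sup>2 / 2 * exp 6) * exp (t * F x) / 2"
    by (intro divide_right_mono mult_right_mono abs_exp_minus_second_order s6) auto
  also have "s\<^sup>2 = 4 * t\<^sup>2 * (d k x)\<^sup>2"
    using arg_cong[OF abs_s, of "\<lambda>s. s\<^sup>2"] by (simp add: power_mult_distrib)
  finally show "\<bar>x k * (exp (t * F x) - exp (t * F (flip k x))) / 2 - t * d k x * exp (t * F x)\<bar>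
          \<le> t\<^sup>2 * (d k x)\<^sup>2 * exp 6 * exp (t * F x)" by simp
qed

text \<open>Let h be the tilted first absolute moment. Integration by parts bounds the tilted second
  moment by a multiple of C^2 mgf + t C h: the first term arises when the flip acts on
  \<open>H\<close>, the second when it acts on the weight. Cauchy-Schwarz then yields a quadratic
  inequality for h.\<close>

lemma tilted_moment:
  assumes t: "admissible t"
    and H: "\<And>x. x \<in> cube J \<Longrightarrow> H x = (\<Sum>k\<in>J. x k * y k x)"
    and y_flip: "\<And>k x. y k (flip k x) = y k x"
    and y_le: "\<And>k x. x \<in> cube J \<Longrightarrow> \<bar>y k x\<bar> \<le> (mu k)\<^sup>2"
    and H_flip: "\<And>k x. k \<in> J \<Longrightarrow> x \<in> cube J \<Longrightarrow> \<bar>H x - H (flip k x)\<bar> \<le> 2 * (mu k)\<^sup>2"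
  shows "avg J (\<lambda>x. \<bar>H x\<bar> * exp (t * F x)) \<le> chain_const * C * (1 + t) * mgf t"
proof (rule ccontr)
  define L where "L = exp (6::real)"
  have L1: "L \<ge> 1" by (simp add: L_def)
  have t0: "t \<ge> 0" using t by (simp add: admissible_def)
  define h where "h = avg J (\<lambda>x. \<bar>H x\<bar> * exp (t * F x))"
  have h0: "h \<ge> 0" unfolding h_def by (intro avg_nonneg) auto
  let ?e = "\<lambda>x. exp (t * F x)"
  \<comment> \<open>Only one of the two factors \<open>H\<close> is expanded; the other one stays
    with the weight and is differentiated.\<close>
  have "avg J (\<lambda>x. (H x)\<^sup>2 * ?e x) = avg J (\<lambda>x. \<Sum>k\<in>J. x k * y k x * (H x * ?e x))"
    by (rule avg_cong) (simp add: power2_eq_square H sum_distrib_right mult.assoc)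
  also have "\<dots> = (\<Sum>k\<in>J. avg J (\<lambda>x. y k x * (x k * (H x * ?e x - H (flip k x) * ?e (flip k x)) / 2)))"
    unfolding avg_sum by (intro sum.cong refl avg_by_parts) (simp_all add: y_flip)
  also have "\<dots> \<le> (\<Sum>k\<in>J. avg J (\<lambda>x. (mu k ^ 4 * L) * ?e x + (t * mu k ^ 3 * L) * (\<bar>H x\<bar> * ?e x)))"
  proof (intro sum_mono avg_mono)
    fix k x assume k: "k \<in> J" and x: "x \<in> cube J"
    have "\<bar>H x * ?e x - H (flip k x) * ?e (flip k x)\<bar>
        = \<bar>(H x - H (flip k x)) * ?e (flip k x) + H x * (?e x - ?e (flip k x))\<bar>"
      by (simp add: algebra_simps)
    also have "\<dots> \<le> \<bar>H x - H (flip k x)\<bar> * ?e (flip k x) + \<bar>H x\<bar> * \<bar>?e x - ?e (flip k x)\<bar>"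
      using abs_triangle_ineq by (simp add: abs_mult order.trans[OF abs_triangle_ineq])
    also have "\<dots> \<le> (2 * (mu k)\<^sup>2) * (L * ?e x) + \<bar>H x\<bar> * (2 * t * mu k * L * ?e x)"
    proof (intro add_mono mult_mono H_flip k x)
      show "?e (flip k x) \<le> L * ?e x" unfolding L_def by (rule exp_flip_le[OF t x k])
      have "\<bar>?e x - ?e (flip k x)\<bar> \<le> 2 * t * \<bar>d k x\<bar> * L * ?e x" unfolding L_def by (rule exp_flip_diff[OF t x k])
      also have "\<dots> \<le> 2 * t * mu k * L * ?e x"
        using t0 L1 abs_d_le_mu[OF x, of k] by (intro mult_right_mono mult_left_mono) auto
      finally show "\<bar>?e x - ?e (flip k x)\<bar> \<le> 2 * t * mu k * L * ?e x" .
    qed auto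
    finally have *: "\<bar>H x * ?e x - H (flip k x) * ?e (flip k x)\<bar> / 2
       \<le> (mu k)\<^sup>2 * L * ?e x + t * mu k * L * (\<bar>H x\<bar> * ?e x)" by (simp add: algebra_simps)
    have "y k x * (x k * (H x * ?e x - H (flip k x) * ?e (flip k x)) / 2)
        \<le> \<bar>y k x\<bar> * (\<bar>H x * ?e x - H (flip k x) * ?e (flip k x)\<bar> / 2)"
      by (rule order.trans[OF abs_ge_self]) (simp add: abs_mult cube_abs[OF x])
    also have "\<dots> \<le> (mu k)\<^sup>2 * ((mu k)\<^sup>2 * L * ?e x + t * mu k * L * (\<bar>H x\<bar> * ?e x))"
      by (intro mult_mono y_le x *) auto
    also have "\<dots> = (mu k ^ 4 * L) * ?e x + (t * mu k ^ 3 * L) * (\<bar>H x\<bar> * ?e x)"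
      by (simp add: algebra_simps eval_nat_numeral)
    finally show "y k x * (x k * (H x * ?e x - H (flip k x) * ?e (flip k x)) / 2)
        \<le> (mu k ^ 4 * L) * ?e x + (t * mu k ^ 3 * L) * (\<bar>H x\<bar> * ?e x)" .
  qed
  also have "\<dots> = (\<Sum>k\<in>J. mu k ^ 4) * (L * mgf t) + (\<Sum>k\<in>J. mu k ^ 3) * (t * L * h)"
    unfolding avg_add avg_cmult mgf_def[symmetric] h_def[symmetric]
    by (simp add: sum.distrib sum_distrib_right mult.assoc) (simp add: mult_ac)
  also have "\<dots> \<le> (625 * C\<^sup>2) * (L * mgf t) + (500 * C) * (t * L * h)"
    using t0 L1 h0 mgf_pos[of t] by (intro add_mono mult_right_mono sum_mu4 sum_mu3) auto
  also have "\<dots> \<le> 625 * L * (C\<^sup>2 * mgf t + t * C * h)"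
    using t0 L1 h0 C_nonneg by (simp add: algebra_simps mult_left_mono)
  finally have H2: "avg J (\<lambda>x. (H x)\<^sup>2 * ?e x) \<le> 625 * L * (C\<^sup>2 * mgf t + t * C * h)" .
  have "h\<^sup>2 = (avg J (\<lambda>x. (\<bar>H x\<bar> * exp (t * F x / 2)) * exp (t * F x / 2)))\<^sup>2"
    unfolding h_def by (rule arg_cong[of _ _ "\<lambda>r. r\<^sup>2"], rule avg_cong) (simp flip: exp_add)
  also have "\<dots> \<le> avg J (\<lambda>x. (\<bar>H x\<bar> * exp (t * F x / 2))\<^sup>2) * avg J (\<lambda>x. (exp (t * F x / 2))\<^sup>2)"
    by (rule avg_Cauchy_Schwarz)
  also have "\<dots> = avg J (\<lambda>x. (H x)\<^sup>2 * ?e x) * mgf t"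
    unfolding mgf_def by (simp add: power_mult_distrib power2_eq_square[of "exp _"] flip: exp_add)
  also have "\<dots> \<le> 625 * L * (C\<^sup>2 * mgf t + t * C * h) * mgf t"
    using mgf_pos[of t] by (intro mult_right_mono H2) auto
  finally have h2: "h\<^sup>2 \<le> 625 * L * (C\<^sup>2 * mgf t + t * C * h) * mgf t" .
  \<comment> \<open>If the bound failed, h would exceed C mgf. Then C^2 mgf^2 <= C mgf h, and
    dividing the quadratic inequality by h gives the bound after all.\<close>
  assume "\<not> ?thesis"
  then have big: "h > 625 * L * C * (1 + t) * mgf t" by (simp add: h_def L_def chain_const_def)
  have cm: "0 \<le> C * mgf t" using C_nonneg mgf_pos[of t] by simp
  have "1 * (C * mgf t) \<le> (625 * L * (1 + t)) * (C * mgf t)"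
  proof (rule mult_right_mono[OF _ cm])
    have "1 * 1 \<le> (625 * L) * (1 + t)" using L1 t0 by (intro mult_mono) auto
    then show "1 \<le> 625 * L * (1 + t)" by simp
  qed
  with big have Cm: "C * mgf t \<le> h" by (simp add: algebra_simps)
  have "0 \<le> 625 * L * C * (1 + t) * mgf t" using L1 C_nonneg t0 mgf_pos[of t] by simp
  with big have hp: "h > 0" by linarith
  have "(C * mgf t) * (C * mgf t) \<le> (C * mgf t) * h" using Cm cm by (intro mult_left_mono)
  then have "625 * L * ((C * mgf t) * (C * mgf t)) \<le> 625 * L * ((C * mgf t) * h)"
    by (rule mult_left_mono) (use L1 in simp)
  then have "h * h \<le> (625 * L * C * (1 + t) * mgf t) * h"
    using h2 by (simp add: power2_eq_square algebra_simps)
  with hp big show False by (simp add: mult_le_cancel_right)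
qed

lemma tilted_A: "admissible t \<Longrightarrow> avg J (\<lambda>x. \<bar>A x\<bar> * exp (t * F x)) \<le> chain_const * C * (1 + t) * mgf t"
  by (rule tilted_moment[where y = yA]) (auto intro: A_eq yA_flip abs_yA_le A_flip_le)

lemma tilted_B: "admissible t \<Longrightarrow> avg J (\<lambda>x. \<bar>B x\<bar> * exp (t * F x)) \<le> chain_const * C * (1 + t) * mgf t"
proof (rule tilted_moment[where y = "\<lambda>k x. \<bar>u k x\<bar> * d k x"])
  fix k x assume x: "x \<in> cube J"
  have "\<bar>u k x\<bar> * \<bar>d k x\<bar> \<le> mu k * mu k" by (intro mult_mono abs_u_le_mu abs_d_le_mu x mu_nonneg) auto
  then show "\<bar>\<bar>u k x\<bar> * d k x\<bar> \<le> (mu k)\<^sup>2" by (simp add: abs_mult power2_eq_square)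
qed (auto simp: B_def[symmetric] u_flip d_flip B_flip_le)

lemma DERIV_mgf: "(mgf has_real_derivative avg J (\<lambda>x. F x * exp (t * F x))) (at t)"
  unfolding mgf_def avg_def
  by (auto intro!: derivative_eq_intros simp: mult.commute card_cube)

text \<open>For a Gaussian the derivative would be t * mgf. The fluctuation \<open>A\<close> costs C
  t (1 + t), and replacing the discrete derivative of exp (t F) by t d k exp (t F) costs C t^2
  through \<open>sum_mu3\<close>; hence t + 2 t^2.\<close>

lemma mgf_derivative_le:
  assumes t: "admissible t"
  shows "avg J (\<lambda>x. F x * exp (t * F x)) \<le> (t + chain_const * C * (t + 2 * t\<^sup>2)) * mgf t"
proof -
  define L where "L = exp (6::real)"
  let ?e = "\<lambda>x. exp (t * F x)"
  have L1: "L \<ge> 1" by (simp add: L_def)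
  have t0: "t \<ge> 0" using t by (simp add: admissible_def)
  have "avg J (\<lambda>x. F x * ?e x) - t * avg J (\<lambda>x. (1 - A x) * ?e x)
     = (\<Sum>k\<in>J. avg J (\<lambda>x. u k x * (x k * (?e x - ?e (flip k x)) / 2))) - t * avg J (\<lambda>x. \<Sum>k\<in>J. u k x * d k x * ?e x)"
    by (simp add: avg_F_times A_def var_1 sum_distrib_right)
  also have "\<dots> = (\<Sum>k\<in>J. avg J (\<lambda>x. u k x * (x k * (?e x - ?e (flip k x)) / 2 - t * d k x * ?e x)))"
    unfolding avg_sum sum_distrib_left avg_cmult[symmetric] sum_subtractf[symmetric] avg_diff[symmetric]
    by (intro sum.cong refl avg_cong) (simp add: algebra_simps)
  also have "\<dots> \<le> (\<Sum>k\<in>J. avg J (\<lambda>x. (mu k ^ 3 * t\<^sup>2 * L) * ?e x))"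
  proof (intro sum_mono avg_mono)
    fix k x assume k: "k \<in> J" and x: "x \<in> cube J"
    have "u k x * (x k * (?e x - ?e (flip k x)) / 2 - t * d k x * ?e x)
      \<le> \<bar>u k x\<bar> * \<bar>x k * (?e x - ?e (flip k x)) / 2 - t * d k x * ?e x\<bar>"
      unfolding abs_mult[symmetric] by simp
    also have "\<dots> \<le> mu k * (t\<^sup>2 * (mu k)\<^sup>2 * L * ?e x)"
    proof (intro mult_mono abs_u_le_mu x mu_nonneg)
      have "\<bar>x k * (?e x - ?e (flip k x)) / 2 - t * d k x * ?e x\<bar> \<le> t\<^sup>2 * (d k x)\<^sup>2 * L * ?e x"
        unfolding L_def by (rule exp_flip_taylor[OF t x k])
      also have "\<dots> \<le> t\<^sup>2 * (mu k)\<^sup>2 * L * ?e x"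
        using power_mono[OF abs_d_le_mu[OF x, of k], of 2] L1 by (intro mult_right_mono mult_left_mono) auto
      finally show "\<bar>x k * (?e x - ?e (flip k x)) / 2 - t * d k x * ?e x\<bar> \<le> t\<^sup>2 * (mu k)\<^sup>2 * L * ?e x" .
    qed auto
    also have "\<dots> = (mu k ^ 3 * t\<^sup>2 * L) * ?e x" by (simp add: power3_eq_cube power2_eq_square)
    finally show "u k x * (x k * (?e x - ?e (flip k x)) / 2 - t * d k x * ?e x) \<le> (mu k ^ 3 * t\<^sup>2 * L) * ?e x" .
  qed
  also have "\<dots> = (\<Sum>k\<in>J. mu k ^ 3) * (t\<^sup>2 * L * mgf t)"
    by (simp add: avg_cmult mgf_def sum_distrib_right mult.assoc)
  also have "\<dots> \<le> (500 * C) * (t\<^sup>2 * L * mgf t)"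
    using L1 mgf_pos[of t] by (intro mult_right_mono sum_mu3) auto
  also have "\<dots> \<le> 625 * C * (t\<^sup>2 * L * mgf t)"
    using L1 mgf_pos[of t] C_nonneg by (intro mult_right_mono) auto
  finally have 1: "avg J (\<lambda>x. F x * ?e x) - t * avg J (\<lambda>x. (1 - A x) * ?e x) \<le> 625 * C * (t\<^sup>2 * L * mgf t)" .
  have "avg J (\<lambda>x. (1 - A x) * ?e x) \<le> avg J (\<lambda>x. ?e x + \<bar>A x\<bar> * ?e x)"
  proof (rule avg_mono)
    fix x
    have "(1 - A x) * ?e x \<le> (1 + \<bar>A x\<bar>) * ?e x" by (intro mult_right_mono) auto
    then show "(1 - A x) * ?e x \<le> ?e x + \<bar>A x\<bar> * ?e x" by (simp add: algebra_simps)
  qed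
  also have "\<dots> \<le> mgf t + 625 * L * C * (1 + t) * mgf t"
    unfolding avg_add mgf_def[symmetric] L_def using tilted_A[OF t] by (simp add: chain_const_def)
  finally have "t * avg J (\<lambda>x. (1 - A x) * ?e x) \<le> t * (mgf t + 625 * L * C * (1 + t) * mgf t)"
    using t0 by (rule mult_left_mono)
  with 1 show ?thesis by (simp add: chain_const_def L_def[symmetric] algebra_simps power2_eq_square)
qed

lemma mgf_0: "mgf 0 = 1" unfolding mgf_def by (simp add: avg_const)

text \<open>A Gronwall argument: \<open>q\<close> is the integral of the rate in
  \<open>mgf_derivative_le\<close>, so mgf times exp (- q) is nonincreasing. Both t^2 C and t^3 C
  are at most 16, and 16/2 + (2/3) * 16 is below 32.\<close>

lemma mgf_le:
  assumes t: "admissible t"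
  shows "mgf t \<le> exp (32 * chain_const) * exp (t\<^sup>2 / 2)"
proof -
  define M where "M = chain_const"
  define q where "q s = s\<^sup>2 / 2 + M * C * (s\<^sup>2 / 2 + 2 / 3 * s ^ 3)" for s
  have M0: "M \<ge> 0" using chain_const_pos by (simp add: M_def)
  have t0: "t \<ge> 0" "t ^ 3 * C \<le> 16" "C \<le> 2" using t by (auto simp: admissible_def)
  have "mgf t * exp (- q t) \<le> mgf 0 * exp (- q 0)"
  proof (rule DERIV_nonpos_imp_nonincreasing[OF t0(1)])
    fix s assume s: "0 \<le> s" "s \<le> t"
    have qd: "(q has_real_derivative (s + M * C * (s + 2 * s\<^sup>2))) (at s)"
      unfolding q_def[abs_def] by (auto intro!: derivative_eq_intros)
    have "((\<lambda>s. mgf s * exp (- q s)) has_real_derivative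
        (avg J (\<lambda>x. F x * exp (s * F x)) - (s + M * C * (s + 2 * s\<^sup>2)) * mgf s) * exp (- q s)) (at s)"
      by (rule derivative_eq_intros DERIV_mgf qd refl)+ (simp add: algebra_simps)
    moreover have "(avg J (\<lambda>x. F x * exp (s * F x)) - (s + M * C * (s + 2 * s\<^sup>2)) * mgf s) * exp (- q s) \<le> 0"
      using mgf_derivative_le[OF admissible_mono[OF t s]]
      by (intro mult_nonpos_nonneg) (auto simp: M_def)
    ultimately show "\<exists>y. ((\<lambda>s. mgf s * exp (- q s)) has_real_derivative y) (at s) \<and> y \<le> 0" by blast
  qed
  then have "mgf t * exp (- q t) \<le> 1" by (simp add: mgf_0 q_def)
  then have "mgf t \<le> exp (q t)" by (simp add: exp_minus field_simps)
  also have "q t \<le> 32 * M + t\<^sup>2 / 2"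
  proof -
    have "t\<^sup>2 * C \<le> 16"
    proof (cases "t \<le> 1")
      case True
      then have "t\<^sup>2 * C \<le> 1 * 2" using t0 C_nonneg by (intro mult_mono) (auto simp: power_le_one)
      then show ?thesis by simp
    next
      case False
      then have "t\<^sup>2 * C \<le> t ^ 3 * C" using C_nonneg by (intro mult_right_mono power_increasing) auto
      with t0 show ?thesis by simp
    qed
    with t0 have "M * (t\<^sup>2 * C / 2 + 2 / 3 * (t ^ 3 * C)) \<le> M * 32"
      using M0 by (intro mult_left_mono) auto
    then show ?thesis by (simp add: q_def algebra_simps)
  qed
  finally show ?thesis by (simp add: M_def exp_add)
qed

lemma times_stein_vs_derivative:
  "\<bar>avg J (\<lambda>x. F x * stein z (F x)) - avg J (\<lambda>x. (1 - A x) * stein' z (F x))\<bar>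
     \<le> 2 * avg J (\<lambda>x. B x * stein_mono z (F x))"
proof -
  have "avg J (\<lambda>x. F x * stein z (F x)) - avg J (\<lambda>x. (1 - A x) * stein' z (F x))
     = (\<Sum>k\<in>J. avg J (\<lambda>x. u k x * (x k * (stein z (F x) - stein z (F (flip k x))) / 2)))
       - avg J (\<lambda>x. \<Sum>k\<in>J. u k x * d k x * stein' z (F x))"
    by (simp add: avg_F_times A_def var_1 sum_distrib_right)
  also have "\<dots> = (\<Sum>k\<in>J. avg J (\<lambda>x. u k x * (x k * (stein z (F x) - stein z (F (flip k x))) / 2 - d k x * stein' z (F x))))"
    unfolding avg_sum sum_subtractf[symmetric] avg_diff[symmetric]
    by (intro sum.cong refl avg_cong) (simp add: algebra_simps)
  finally have "\<bar>avg J (\<lambda>x. F x * stein z (F x)) - avg J (\<lambda>x. (1 - A x) * stein' z (F x))\<bar>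
     \<le> (\<Sum>k\<in>J. avg J (\<lambda>x. \<bar>u k x * (x k * (stein z (F x) - stein z (F (flip k x))) / 2 - d k x * stein' z (F x))\<bar>))"
    by (simp only:) (rule order.trans[OF sum_abs], intro sum_mono avg_abs_le)
  also have "\<dots> \<le> (\<Sum>k\<in>J. avg J (\<lambda>x. 2 * ((\<bar>u k x\<bar> * d k x) * (x k * (stein_mono z (F x) - stein_mono z (F (flip k x))) / 2))))"
  proof (intro sum_mono avg_mono)
    fix k x assume k: "k \<in> J" and x: "x \<in> cube J"
    let ?p = "F x" and ?q = "F (flip k x)"
    have pq: "?p - ?q = 2 * x k * d k x" by (simp add: F_flip[OF k])
    have "x k * (stein z ?p - stein z ?q) / 2 - d k x * stein' z ?p
        = x k / 2 * (stein z ?p - stein z ?q - (?p - ?q) * stein' z ?p)"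
    proof -
      have "x k / 2 * (stein z ?p - stein z ?q - (2 * x k * d k x) * stein' z ?p)
          = x k * (stein z ?p - stein z ?q) / 2 - (x k * x k) * (d k x * stein' z ?p)"
        by (simp add: field_simps)
      then show ?thesis unfolding pq cube_square[OF x] by simp
    qed
    then have "\<bar>u k x * (x k * (stein z ?p - stein z ?q) / 2 - d k x * stein' z ?p)\<bar>
        = \<bar>u k x\<bar> / 2 * \<bar>stein z ?p - stein z ?q - (?p - ?q) * stein' z ?p\<bar>"
      by (simp only: abs_mult abs_divide cube_abs[OF x])
    also have "\<dots> \<le> \<bar>u k x\<bar> / 2 * ((?p - ?q) * (stein_mono z ?p - stein_mono z ?q))"
      by (intro mult_left_mono stein_taylor) auto
    also have "\<dots> = 2 * ((\<bar>u k x\<bar> * d k x) * (x k * (stein_mono z ?p - stein_mono z ?q) / 2))"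
      unfolding pq by simp
    finally show "\<bar>u k x * (x k * (stein z ?p - stein z ?q) / 2 - d k x * stein' z ?p)\<bar>
       \<le> 2 * ((\<bar>u k x\<bar> * d k x) * (x k * (stein_mono z ?p - stein_mono z ?q) / 2))" .
  qed
  \<comment> \<open>Integration by parts read backwards, which is possible since |u k| d k is
    invariant under the flip at \<open>k\<close>.\<close>
  also have "\<dots> = 2 * (\<Sum>k\<in>J. avg J (\<lambda>x. x k * (\<bar>u k x\<bar> * d k x) * stein_mono z (F x)))"
    unfolding avg_cmult sum_distrib_left
    by (intro sum.cong refl arg_cong[of _ _ "\<lambda>r. 2 * r"] avg_by_parts[symmetric]) (simp_all add: u_flip d_flip)
  also have "\<dots> = 2 * avg J (\<lambda>x. B x * stein_mono z (F x))"
    unfolding avg_sum[symmetric] B_def by (simp add: sum_distrib_right)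
  finally show ?thesis .
qed

text \<open>In summand j the factor exp (- j^2 / 2) cancels the Gaussian bound on mgf j, leaving j
  (1 + j), which sums to order (1 + z)(1 + z^2). In the last term exp (- z^2 / 2) remains, which
  \<open>std_normal_le_tail\<close> compares with \<open>1 - Phi z\<close>.\<close>

lemma avg_stein_majorant:
  assumes z: "0 \<le> z" "z ^ 3 * C \<le> 2" "C \<le> 2"
    and H: "\<And>t. admissible t \<Longrightarrow> avg J (\<lambda>x. \<bar>H x\<bar> * exp (t * F x)) \<le> chain_const * C * (1 + t) * mgf t"
  shows "avg J (\<lambda>x. \<bar>H x\<bar> * stein_majorant z (F x))
     \<le> 66 * (chain_const * exp (32 * chain_const)) * C * (1 - Phi z) * ((1 + z) * (1 + z\<^sup>2))"
proof -
  define G where "G = chain_const * exp (32 * chain_const) * C"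
  define n where "n = nat \<lceil>z\<rceil>"
  have G0: "G \<ge> 0" using C_nonneg chain_const_pos by (simp add: G_def)
  have n: "real n \<le> z + 1" using z unfolding n_def by linarith
  have p: "1 - Phi z > 0" using Phi_less_1[of z] by simp
  \<comment> \<open>Rounding up may raise the exponents to z + 1. Convexity of the cube costs a
    factor 4, and 4 * (2 + 2) = 16.\<close>
  have "(z + 1) ^ 3 * C \<le> 16"
  proof -
    have "4 * (z ^ 3 + 1) - (z + 1) ^ 3 = 3 * ((z - 1)\<^sup>2 * (z + 1))"
      by (simp add: power2_eq_square power3_eq_cube algebra_simps)
    also have "\<dots> \<ge> 0" using z by simp
    finally have "(z + 1) ^ 3 \<le> 4 * (z ^ 3 + 1)" by simp
    then have "(z + 1) ^ 3 * C \<le> 4 * (z ^ 3 + 1) * C" using C_nonneg by (intro mult_right_mono)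
    also have "\<dots> \<le> 16" using z by (simp add: algebra_simps)
    finally show ?thesis .
  qed
  then have adm: "admissible (z + 1)" using z by (simp add: admissible_def)
  have mom: "avg J (\<lambda>x. \<bar>H x\<bar> * exp (t * F x)) \<le> G * (1 + t) * exp (t\<^sup>2 / 2)" if "0 \<le> t" "t \<le> z + 1" for t
  proof -
    have a: "admissible t" using admissible_mono[OF adm] that by simp
    have "avg J (\<lambda>x. \<bar>H x\<bar> * exp (t * F x)) \<le> chain_const * C * (1 + t) * mgf t" by (rule H[OF a])
    also have "\<dots> \<le> chain_const * C * (1 + t) * (exp (32 * chain_const) * exp (t\<^sup>2 / 2))"
      using C_nonneg chain_const_pos that by (intro mult_left_mono mgf_le a) auto
    finally show ?thesis by (simp add: G_def mult_ac)
  qed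
  have "avg J (\<lambda>x. \<bar>H x\<bar> * stein_majorant z (F x))
     = avg J (\<lambda>x. (1 - Phi z) * (\<bar>H x\<bar> * exp (0 * F x) + 5 * (\<Sum>j=1..n. real j * exp (- (real j)\<^sup>2 / 2) * (\<bar>H x\<bar> * exp (real j * F x))))
          + 2 * exp (- z\<^sup>2) * (\<bar>H x\<bar> * exp (z * F x)))"
  proof (rule avg_cong)
    fix x
    have s: "(\<Sum>j=1..n. real j * exp (real j * F x - (real j)\<^sup>2 / 2)) * \<bar>H x\<bar>
       = (\<Sum>j=1..n. real j * exp (- (real j)\<^sup>2 / 2) * (\<bar>H x\<bar> * exp (real j * F x)))"
      unfolding sum_distrib_right by (intro sum.cong refl) (simp add: mult_ac flip: exp_add)
    have e: "exp (z * F x - z\<^sup>2) = exp (- z\<^sup>2) * exp (z * F x)" by (simp flip: exp_add)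
    show "\<bar>H x\<bar> * stein_majorant z (F x) = (1 - Phi z) * (\<bar>H x\<bar> * exp (0 * F x) + 5 * (\<Sum>j=1..n. real j * exp (- (real j)\<^sup>2 / 2) * (\<bar>H x\<bar> * exp (real j * F x))))
          + 2 * exp (- z\<^sup>2) * (\<bar>H x\<bar> * exp (z * F x))"
      unfolding s[symmetric] stein_majorant_def n_def[symmetric] e by (simp add: algebra_simps)
  qed
  also have "\<dots> = (1 - Phi z) * (avg J (\<lambda>x. \<bar>H x\<bar> * exp (0 * F x)) + 5 * (\<Sum>j=1..n. real j * exp (- (real j)\<^sup>2 / 2) * avg J (\<lambda>x. \<bar>H x\<bar> * exp (real j * F x))))
          + 2 * exp (- z\<^sup>2) * avg J (\<lambda>x. \<bar>H x\<bar> * exp (z * F x))"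
    by (simp only: avg_add avg_cmult avg_sum)
  also have "\<dots> \<le> (1 - Phi z) * (G * (1 + 0) * exp (0\<^sup>2 / 2) + 5 * (\<Sum>j=1..n. real j * exp (- (real j)\<^sup>2 / 2) * (G * (1 + real j) * exp ((real j)\<^sup>2 / 2))))
          + 2 * exp (- z\<^sup>2) * (G * (1 + z) * exp (z\<^sup>2 / 2))"
    using p z n by (intro add_mono mult_left_mono mom sum_mono) auto
  also have "\<dots> = G * ((1 - Phi z) * (1 + 5 * (\<Sum>j=1..n. real j * (1 + real j))) + 2 * (1 + z) * exp (- z\<^sup>2 / 2))"
  proof -
    have "(\<Sum>j=1..n. real j * exp (- (real j)\<^sup>2 / 2) * (G * (1 + real j) * exp ((real j)\<^sup>2 / 2))) = G * (\<Sum>j=1..n. real j * (1 + real j))"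
      unfolding sum_distrib_left by (intro sum.cong refl) (simp add: exp_minus)
    moreover have "exp (- z\<^sup>2) * exp (z\<^sup>2 / 2) = exp (- z\<^sup>2 / 2)" by (simp flip: exp_add)
    ultimately show ?thesis by (simp add: algebra_simps)
  qed
  also have "\<dots> \<le> G * ((1 - Phi z) * (1 + 5 * (4 * ((1 + z) * (1 + z\<^sup>2)))) + (1 - Phi z) * (24 * ((1 + z) * (1 + z\<^sup>2))))"
  proof (intro mult_left_mono add_mono G0)
    have zz: "(1 + z)\<^sup>2 \<le> 2 * (1 + z\<^sup>2)"
      using sum_squares_bound[of 1 z] by (simp add: power2_eq_square algebra_simps)
    have "(\<Sum>j=1..n. real j * (1 + real j)) \<le> (\<Sum>j=1..n. (1 + z) * (2 + z))"
      using n z by (intro sum_mono mult_mono) auto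
    also have "\<dots> \<le> (1 + z) * ((1 + z) * (2 + z))" using n z by (auto intro!: mult_right_mono)
    also have "\<dots> \<le> (1 + z) * ((1 + z) * (2 * (1 + z)))" using z by (intro mult_left_mono) auto
    also have "\<dots> = 2 * (1 + z) * (1 + z)\<^sup>2" by (simp add: power2_eq_square)
    also have "\<dots> \<le> 2 * (1 + z) * (2 * (1 + z\<^sup>2))" using z zz by (intro mult_left_mono) auto
    also have "\<dots> = 4 * ((1 + z) * (1 + z\<^sup>2))" by algebra
    finally show "(\<Sum>j=1..n. real j * (1 + real j)) \<le> 4 * ((1 + z) * (1 + z\<^sup>2))" .
    have "sqrt (2 * pi) \<le> 3" using pi_less_4 by (intro real_le_lsqrt) auto
    have "exp (- z\<^sup>2 / 2) = sqrt (2 * pi) * std_normal_density z" by (simp add: std_normal_density_def)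
    also have "\<dots> \<le> 3 * ((z + 2) * (1 - Phi z))"
      using \<open>sqrt (2 * pi) \<le> 3\<close> z by (intro mult_mono std_normal_le_tail) auto
    also have "\<dots> \<le> 3 * ((2 * (1 + z)) * (1 - Phi z))" using z p by (intro mult_left_mono mult_right_mono) auto
    finally have "2 * (1 + z) * exp (- z\<^sup>2 / 2) \<le> 2 * (1 + z) * (3 * ((2 * (1 + z)) * (1 - Phi z)))"
      using z by (intro mult_left_mono) auto
    also have "\<dots> = (1 - Phi z) * (12 * (1 + z)\<^sup>2)" by algebra
    also have "\<dots> \<le> (1 - Phi z) * (24 * ((1 + z) * (1 + z\<^sup>2)))"
    proof (intro mult_left_mono)
      have "1 * (1 + z\<^sup>2) \<le> (1 + z) * (1 + z\<^sup>2)" using z by (intro mult_right_mono) auto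
      then show "12 * (1 + z)\<^sup>2 \<le> 24 * ((1 + z) * (1 + z\<^sup>2))" using zz by linarith
    qed (use p in auto)
    finally show "2 * (1 + z) * exp (- z\<^sup>2 / 2) \<le> (1 - Phi z) * (24 * ((1 + z) * (1 + z\<^sup>2)))" .
  qed (use p in auto)
  also have "\<dots> \<le> G * ((1 - Phi z) * (66 * ((1 + z) * (1 + z\<^sup>2))))"
  proof -
    have "1 * 1 \<le> (1 + z) * (1 + z\<^sup>2)" using z by (intro mult_mono) auto
    then have "(1 - Phi z) * (1 + 44 * ((1 + z) * (1 + z\<^sup>2))) \<le> (1 - Phi z) * (66 * ((1 + z) * (1 + z\<^sup>2)))"
      using p by (intro mult_left_mono) auto
    then show ?thesis using G0 by (intro mult_left_mono) (auto simp: algebra_simps)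
  qed
  finally show ?thesis by (simp only: G_def mult_ac)
qed

lemma unit_tail_bound:
  assumes z: "0 \<le> z" "z ^ 3 * C \<le> 2" "C \<le> 2"
  shows "\<bar>avg J (\<lambda>x. of_bool (F x > z)) - (1 - Phi z)\<bar>
    \<le> 200 * (chain_const * exp (32 * chain_const)) * C * (1 - Phi z) * ((1 + z) * (1 + z\<^sup>2))"
proof -
  define R where "R = 66 * (chain_const * exp (32 * chain_const)) * C * (1 - Phi z) * ((1 + z) * (1 + z\<^sup>2))"
  have R: "0 \<le> R" using z C_nonneg chain_const_pos Phi_less_1[of z] by (auto simp: R_def)
  have "avg J (\<lambda>x. of_bool (F x > z)) - (1 - Phi z) = avg J (\<lambda>x. of_bool (F x > z) - (1 - Phi z))"
    by (simp add: avg_diff avg_const)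
  \<comment> \<open>By the Stein equation the integrand is F f - f'; here f' is split into (1 - A)
    f' and A f'. The first part is what integration by parts produces from F f. In the end
    \<open>A\<close> is charged once and \<open>B\<close> twice, and 3 * 66 <= 200.\<close>
  also have "\<dots> = avg J (\<lambda>x. (F x * stein z (F x) - (1 - A x) * stein' z (F x)) - A x * stein' z (F x))"
    by (rule avg_cong) (simp add: stein'_def algebra_simps)
  finally have eq: "avg J (\<lambda>x. of_bool (F x > z)) - (1 - Phi z)
     = (avg J (\<lambda>x. F x * stein z (F x)) - avg J (\<lambda>x. (1 - A x) * stein' z (F x))) - avg J (\<lambda>x. A x * stein' z (F x))"
    by (simp only: avg_diff)
  have "\<bar>avg J (\<lambda>x. A x * stein' z (F x))\<bar> \<le> avg J (\<lambda>x. \<bar>A x\<bar> * stein_majorant z (F x))"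
    by (rule order.trans[OF avg_abs_le avg_mono])
       (auto simp: abs_mult intro!: mult_left_mono abs_stein_le_majorant z)
  also have "\<dots> \<le> R" unfolding R_def by (rule avg_stein_majorant[OF z tilted_A])
  finally have 1: "\<bar>avg J (\<lambda>x. A x * stein' z (F x))\<bar> \<le> R" .
  have "avg J (\<lambda>x. B x * stein_mono z (F x)) \<le> avg J (\<lambda>x. \<bar>B x\<bar> * stein_majorant z (F x))"
  proof (rule avg_mono)
    fix x
    have "B x * stein_mono z (F x) \<le> \<bar>B x\<bar> * \<bar>stein_mono z (F x)\<bar>" unfolding abs_mult[symmetric] by simp
    also have "\<dots> \<le> \<bar>B x\<bar> * stein_majorant z (F x)" by (intro mult_left_mono abs_stein_le_majorant z) simp
    finally show "B x * stein_mono z (F x) \<le> \<bar>B x\<bar> * stein_majorant z (F x)" .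
  qed
  also have "\<dots> \<le> R" unfolding R_def by (rule avg_stein_majorant[OF z tilted_B])
  finally have "\<bar>avg J (\<lambda>x. of_bool (F x > z)) - (1 - Phi z)\<bar> \<le> 3 * R"
    using 1 times_stein_vs_derivative[of z] unfolding eq by linarith
  also have "\<dots> \<le> (200 / 66) * R" using R by (intro mult_right_mono) auto
  also have "\<dots> = 200 * (chain_const * exp (32 * chain_const)) * C * (1 - Phi z) * ((1 + z) * (1 + z\<^sup>2))"
    by (simp add: R_def)
  finally show ?thesis .
qed

end

section \<open>From the cube to Rademacher variables\<close>

definition tail_const :: real where
  "tail_const = 200 * (chain_const * exp (32 * chain_const))"

lemma tail_const_pos: "tail_const > 0" by (simp add: tail_const_def chain_const_pos)

text \<open>Dividing the coefficients by the standard deviation reduces to unit variance.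
  \<open>C\<close> is quadratic in \<open>b\<close>, so it turns into
  \<open>C / var\<close>.\<close>

lemma (in chain) tail_bound:
  assumes v: "var > 0" and z: "0 \<le> z" "z ^ 3 * (C / var) \<le> 2" "C / var \<le> 2"
  shows "\<bar>avg J (\<lambda>x. of_bool (F x > z * sqrt var)) - (1 - Phi z)\<bar>
    \<le> tail_const * (C / var) * (1 - Phi z) * ((1 + z) * (1 + z\<^sup>2))"
proof -
  define b' where "b' k = b k / sqrt var" for k
  interpret n: chain b' N
    by unfold_locales (simp add: b'_def supp)
  have sq: "(r / sqrt var)\<^sup>2 = r\<^sup>2 / var" for r using v by (simp add: power_divide)
  have c': "n.c k = c k / sqrt var" for k
    by (simp add: n.c_def c_def b'_def add_divide_distrib)
  have F': "n.F x = F x / sqrt var" for x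
    unfolding n.F_def F_def b'_def sum_divide_distrib n.J_def J_def by (simp add: field_simps)
  have "n.var = (\<Sum>k\<in>J. ((c k)\<^sup>2 + (b k)\<^sup>2 / 16) / var)"
    unfolding n.var_def
    by (intro sum.cong refl) (simp add: c' b'_def sq add_divide_distrib)
  also have "\<dots> = 1" using v unfolding sum_divide_distrib[symmetric] var_def[symmetric] by simp
  finally have v1: "n.var = 1" .
  interpret n: unit_chain b' N by unfold_locales (rule v1)
  have "sqrt var ^ 4 = ((sqrt var)\<^sup>2)\<^sup>2" by (simp flip: power_mult)
  then have "b' k ^ 4 = b k ^ 4 / var\<^sup>2" for k
    using v by (simp add: b'_def power_divide)
  then have C': "n.C = C / var"
    using v by (simp add: n.C_def C_def sum_divide_distrib[symmetric] real_sqrt_divide)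
  have "(F x / sqrt var > z) = (F x > z * sqrt var)" for x
    using v by (simp add: field_simps)
  then show ?thesis
    using n.unit_tail_bound[of z] z by (simp add: C' F' tail_const_def)
qed

context prob_space
begin

lemma AE_values:
  assumes X [measurable]: "\<And>i. X i \<in> borel_measurable M"
    and 1: "\<And>i::int. prob {\<omega> \<in> space M. X i \<omega> = 1} = 1/2"
    and 2: "\<And>i. prob {\<omega> \<in> space M. X i \<omega> = -1} = 1/2"
  shows "AE \<omega> in M. \<forall>i. X i \<omega> = 1 \<or> X i \<omega> = (-1::real)"
proof (rule AE_all_countable[THEN iffD2], rule allI)
  fix i
  have "prob ({\<omega> \<in> space M. X i \<omega> = 1} \<union> {\<omega> \<in> space M. X i \<omega> = -1}) = 1/2 + 1/2"
    by (subst finite_measure_Union) (auto simp: 1 2)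
  then have "AE \<omega> in M. \<omega> \<in> {\<omega> \<in> space M. X i \<omega> = 1} \<union> {\<omega> \<in> space M. X i \<omega> = -1}"
    by (subst prob_eq_1[symmetric]) auto
  then show "AE \<omega> in M. X i \<omega> = 1 \<or> X i \<omega> = -1" by eventually_elim auto
qed

text \<open>The default 1 off \<open>J\<close> in the argument of \<open>\<phi>\<close> matches the
  one in \<open>cube\<close>. Almost surely the argument is thus a point of the cube, and by
  independence all points are equally likely.\<close>

lemma expectation_eq_avg:
  fixes X :: "int \<Rightarrow> 'a \<Rightarrow> real"
  assumes ind: "indep_vars (\<lambda>_. borel) X UNIV"
    and 1: "\<And>i. prob {\<omega> \<in> space M. X i \<omega> = 1} = 1/2"
    and 2: "\<And>i. prob {\<omega> \<in> space M. X i \<omega> = -1} = 1/2"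
    and J: "finite J" "J \<noteq> {}"
    and meas [measurable]: "f \<in> borel_measurable M"
    and f: "\<And>\<omega>. f \<omega> = \<phi> (\<lambda>i. if i \<in> J then X i \<omega> else 1)"
  shows "expectation f = avg J \<phi>"
proof -
  have X [measurable]: "X i \<in> borel_measurable M" for i
    using ind by (auto simp: indep_vars_def)
  define E where "E x = {\<omega> \<in> space M. \<forall>i\<in>J. X i \<omega> = x i}" for x
  have [measurable]: "E x \<in> sets M" for x unfolding E_def using J(1) by measurable
  have prob_E: "prob (E x) = 1 / real (card (cube J))" if x: "x \<in> cube J" for x
  proof -
    have "E x = (\<Inter>i\<in>J. X i -` {x i} \<inter> space M)" using J by (auto simp: E_def)
    then have "prob (E x) = (\<Prod>i\<in>J. prob (X i -` {x i} \<inter> space M))"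
      using indep_varsD[OF ind J(2,1), of "\<lambda>i. {x i}"] by simp
    also have "\<dots> = (\<Prod>i\<in>J. 1/2)"
    proof (rule prod.cong)
      fix i
      have "X i -` {x i} \<inter> space M = {\<omega> \<in> space M. X i \<omega> = x i}" by auto
      then show "prob (X i -` {x i} \<inter> space M) = 1/2"
        using cube_cases[OF x, of i] 1[of i] 2[of i] by auto
    qed simp
    also have "\<dots> = 1 / real (card (cube J))" by (simp add: card_cube J power_one_over)
    finally show ?thesis .
  qed
  have "expectation f = expectation (\<lambda>\<omega>. \<Sum>x\<in>cube J. \<phi> x * indicator (E x) \<omega>)"
  proof (rule integral_cong_AE)
    show "AE \<omega> in M. f \<omega> = (\<Sum>x\<in>cube J. \<phi> x * indicator (E x) \<omega>)"
      using AE_values[of X, OF X 1 2] AE_space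
    proof eventually_elim
      case (elim \<omega>)
      define y where "y = (\<lambda>i. if i \<in> J then X i \<omega> else 1)"
      have y: "y \<in> cube J" using elim by (auto simp: y_def cube_def PiE_dflt_def)
      have "\<omega> \<in> E x \<longleftrightarrow> x = y" if "x \<in> cube J" for x
        using that elim by (auto simp: E_def y_def cube_def PiE_dflt_def fun_eq_iff)
      then have "(\<Sum>x\<in>cube J. \<phi> x * indicator (E x) \<omega>) = (\<Sum>x\<in>cube J. if x = y then \<phi> x else 0)"
        by (intro sum.cong refl) (auto simp: indicator_def)
      also have "\<dots> = \<phi> y" using y by (simp add: finite_cube J)
      finally show ?case by (simp add: f y_def)
    qed
  qed measurable
  also have "\<dots> = (\<Sum>x\<in>cube J. \<phi> x * prob (E x))"
    by (subst Bochner_Integration.integral_sum) (auto intro!: integrable_mult_right simp: emeasure_eq_measure)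
  also have "\<dots> = (\<Sum>x\<in>cube J. \<phi> x / real (card (cube J)))"
    by (intro sum.cong refl) (simp add: prob_E)
  finally show ?thesis by (simp add: avg_def sum_divide_distrib)
qed

end

definition Gpart :: "nat \<Rightarrow> (int \<Rightarrow> real) \<Rightarrow> (int \<Rightarrow> 'w \<Rightarrow> real) \<Rightarrow> 'w \<Rightarrow> real" where
  "Gpart N a X \<omega> = (\<Sum>i\<in>{- int N..int N}. a i * xi X i \<omega> * xi X (i + 1) \<omega>)"

lemma (in prob_space) Gpart_tail_bound:
  fixes X :: "int \<Rightarrow> 'a \<Rightarrow> real" and a :: "int \<Rightarrow> real" and N :: nat
  defines "E \<equiv> expectation (Gpart N a X)" and "V \<equiv> variance (Gpart N a X)"
  defines "C \<equiv> sqrt (\<Sum>i\<in>{- int N..int N}. a i ^ 4) / V"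
  assumes ind: "indep_vars (\<lambda>_. borel) X UNIV"
    and 1: "\<And>i. prob {\<omega> \<in> space M. X i \<omega> = 1} = 1/2"
    and 2: "\<And>i. prob {\<omega> \<in> space M. X i \<omega> = -1} = 1/2"
    and V: "V > 0" and z: "0 \<le> z" "z ^ 3 * C \<le> 2" "C \<le> 2"
  shows "\<bar>prob {\<omega> \<in> space M. Gpart N a X \<omega> > E + z * sqrt V} - (1 - Phi z)\<bar>
    \<le> tail_const * C * (1 - Phi z) * ((1 + z) * (1 + z\<^sup>2))"
proof -
  have X [measurable]: "X i \<in> borel_measurable M" for i
    using ind by (auto simp: indep_vars_def)
  define b where "b k = (if \<bar>k\<bar> \<le> int N then a k else 0)" for k
  interpret n: chain b "int N" by unfold_locales (auto simp: b_def)
  \<comment> \<open>The constants 1/4 subtracted in \<open>n.F\<close>; since that sum is centred,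
    \<open>m\<close> is the mean of the truncated sum.\<close>
  define m where "m = (\<Sum>k\<in>n.J. b k / 4)"
  have [measurable]: "Gpart N a X \<in> borel_measurable M"
    unfolding Gpart_def[abs_def] xi_def by measurable
  have J: "n.J \<noteq> {}" by (auto simp: n.J_def)
  have sum_b: "(\<Sum>k\<in>{- int N..int N}. g k) = (\<Sum>k\<in>n.J. g k)" if "\<And>k. b k = 0 \<Longrightarrow> \<bar>k\<bar> > int N \<Longrightarrow> g k = 0" for g :: "int \<Rightarrow> real"
    by (rule sum.mono_neutral_left) (auto simp: n.J_def b_def intro!: that)
  have G: "Gpart N a X \<omega> = n.F (\<lambda>i. if i \<in> n.J then X i \<omega> else 1) + m" for \<omega>
  proof -
    have "Gpart N a X \<omega> = (\<Sum>k\<in>{- int N..int N}. b k * ((X k \<omega> + 1) / 2 * ((X (k + 1) \<omega> + 1) / 2)))"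
      unfolding Gpart_def xi_def by (intro sum.cong) (auto simp: b_def)
    also have "\<dots> = (\<Sum>k\<in>n.J. b k * ((X k \<omega> + 1) / 2 * ((X (k + 1) \<omega> + 1) / 2)))"
      by (rule sum_b) simp
    also have "\<dots> = n.F (\<lambda>i. if i \<in> n.J then X i \<omega> else 1) + m"
      unfolding n.F_def m_def sum.distrib[symmetric]
    proof (intro sum.cong refl)
      fix k assume k: "k \<in> n.J"
      show "b k * ((X k \<omega> + 1) / 2 * ((X (k + 1) \<omega> + 1) / 2))
        = b k * (((if k \<in> n.J then X k \<omega> else 1) + 1) / 2 * (((if k + 1 \<in> n.J then X (k + 1) \<omega> else 1) + 1) / 2) - 1 / 4) + b k / 4"
      proof (cases "b k = 0")
        case False
        then have "k + 1 \<in> n.J" by (auto simp: b_def n.J_def split: if_splits)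
        then show ?thesis using k by (simp add: algebra_simps)
      qed simp
    qed
    finally show ?thesis .
  qed
  note ex = expectation_eq_avg[OF ind 1 2 n.finite_J J]
  have E: "E = m"
  proof -
    have "E = avg n.J (\<lambda>x. n.F x + m)" unfolding E_def by (rule ex) (auto simp: G)
    then show ?thesis by (simp add: avg_add n.avg_F avg_const)
  qed
  have var: "V = n.var"
  proof -
    have "V = avg n.J (\<lambda>x. (n.F x)\<^sup>2)"
      unfolding V_def E_def[symmetric] by (rule ex) (measurable, simp add: G E)
    then show ?thesis by (simp add: n.avg_F_square)
  qed
  have "(\<Sum>i\<in>{- int N..int N}. a i ^ 4) = (\<Sum>i\<in>{- int N..int N}. b i ^ 4)"
    by (intro sum.cong refl) (auto simp: b_def)
  then have C: "C = n.C / n.var"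
    unfolding C_def n.C_def var using sum_b[of "\<lambda>k. b k ^ 4"] by simp
  have "prob {\<omega> \<in> space M. Gpart N a X \<omega> > E + z * sqrt V}
      = expectation (indicator {\<omega> \<in> space M. Gpart N a X \<omega> > E + z * sqrt V})" by simp
  also have "\<dots> = expectation (\<lambda>\<omega>. of_bool (Gpart N a X \<omega> > E + z * sqrt V))"
    by (intro Bochner_Integration.integral_cong) (auto simp: indicator_def)
  also have "\<dots> = avg n.J (\<lambda>x. of_bool (n.F x > z * sqrt n.var))"
    by (rule ex) (measurable, simp add: G E var)
  finally show ?thesis
    using n.tail_bound[of z] V z unfolding C var by simp
qed

section \<open>Convergence and measurability of symmetric partial sums\<close>

lemma filterlim_symmetric_interval:
  "filterlim (\<lambda>N. {- int N..int N}) (finite_subsets_at_top UNIV) sequentially"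
proof (rule filterlim_atLeastAtMost_at_bot_at_top)
  show "filterlim int at_top sequentially" by (rule filterlim_int_sequentially)
  show "filterlim (\<lambda>N. - int N) at_bot sequentially"
    unfolding filterlim_at_bot
  proof
    fix Z :: int
    show "\<forall>\<^sub>F N in sequentially. - int N \<le> Z"
      using eventually_ge_at_top[of "nat (- Z)"] by eventually_elim linarith
  qed
qed simp

lemma sum_symmetric_tendsto:
  fixes f :: "int \<Rightarrow> real"
  assumes "f summable_on UNIV"
  shows "(\<lambda>N. \<Sum>i\<in>{- int N..int N}. f i) \<longlonglongrightarrow> (\<Sum>\<^sub>\<infinity>i. f i)"
  using filterlim_compose[OF infsum_tendsto[OF assms] filterlim_symmetric_interval] by simp

text \<open>Both quantifiers on the right range over natural numbers, so the event that a random
  series is summable becomes visibly measurable.\<close>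

lemma summable_iff_bounded:
  fixes f :: "int \<Rightarrow> real"
  shows "f summable_on UNIV \<longleftrightarrow> (\<exists>B::nat. \<forall>N::nat. (\<Sum>i\<in>{- int N..int N}. \<bar>f i\<bar>) \<le> real B)"
proof
  assume "f summable_on UNIV"
  then have s: "(\<lambda>i. \<bar>f i\<bar>) summable_on UNIV"
    using summable_on_iff_abs_summable_on_real[of f UNIV] by simp
  obtain B :: nat where "(\<Sum>\<^sub>\<infinity>i. \<bar>f i\<bar>) \<le> real B" using real_arch_simple by blast
  moreover have "(\<Sum>i\<in>{- int N..int N}. \<bar>f i\<bar>) \<le> (\<Sum>\<^sub>\<infinity>i. \<bar>f i\<bar>)" for N
    by (rule finite_sum_le_infsum[OF s]) auto
  ultimately show "\<exists>B::nat. \<forall>N::nat. (\<Sum>i\<in>{- int N..int N}. \<bar>f i\<bar>) \<le> real B"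
    by (meson order.trans)
next
  assume "\<exists>B::nat. \<forall>N::nat. (\<Sum>i\<in>{- int N..int N}. \<bar>f i\<bar>) \<le> real B"
  then obtain B :: nat where B: "\<And>N::nat. (\<Sum>i\<in>{- int N..int N}. \<bar>f i\<bar>) \<le> real B" by blast
  have "(\<lambda>i. \<bar>f i\<bar>) summable_on UNIV"
  proof (rule nonneg_bdd_above_summable_on)
    show "bdd_above (sum (\<lambda>i. \<bar>f i\<bar>) ` {F. F \<subseteq> UNIV \<and> finite F})"
    proof (rule bdd_aboveI2)
      fix S :: "int set" assume "S \<in> {F. F \<subseteq> UNIV \<and> finite F}"
      then have S: "finite S" by simp
      have "\<forall>\<^sub>F N in sequentially. S \<subseteq> {- int N..int N}"
        using filterlim_symmetric_interval S unfolding filterlim_finite_subsets_at_top by (auto elim: eventually_mono)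
      then obtain N :: nat where "S \<subseteq> {- int N..int N}" by (auto simp: eventually_sequentially)
      then have "sum (\<lambda>i. \<bar>f i\<bar>) S \<le> (\<Sum>i\<in>{- int N..int N}. \<bar>f i\<bar>)" by (intro sum_mono2) auto
      with B[of N] show "sum (\<lambda>i. \<bar>f i\<bar>) S \<le> real B" by linarith
    qed
  qed simp
  then show "f summable_on UNIV" using summable_on_iff_abs_summable_on_real[of f UNIV] by simp
qed

text \<open>An infinite sum has the value 0 where it does not exist. Cutting the partial sums off to
  0 outside the set of summability makes them converge everywhere, not merely almost
  everywhere.\<close>

lemma borel_measurable_infsum_int:
  fixes f :: "int \<Rightarrow> 'w \<Rightarrow> real"
  assumes [measurable]: "\<And>i. f i \<in> borel_measurable M"
  shows "(\<lambda>\<omega>. \<Sum>\<^sub>\<infinity>i. f i \<omega>) \<in> borel_measurable M"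
proof -
  define S where "S \<omega> = (\<exists>B::nat. \<forall>N::nat. (\<Sum>i\<in>{- int N..int N}. \<bar>f i \<omega>\<bar>) \<le> real B)" for \<omega>
  have [measurable]: "Measurable.pred M S" unfolding S_def[abs_def] by measurable
  have S: "S \<omega> \<longleftrightarrow> (\<lambda>i. f i \<omega>) summable_on UNIV" for \<omega>
    unfolding S_def summable_iff_bounded ..
  show ?thesis
  proof (rule borel_measurable_LIMSEQ_real)
    show "(\<lambda>\<omega>. if S \<omega> then \<Sum>i\<in>{- int N..int N}. f i \<omega> else 0) \<in> borel_measurable M" for N :: nat
      by measurable
    fix \<omega>
    show "(\<lambda>N. if S \<omega> then \<Sum>i\<in>{- int N..int N}. f i \<omega> else 0) \<longlonglongrightarrow> (\<Sum>\<^sub>\<infinity>i. f i \<omega>)"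
    proof (cases "S \<omega>")
      case True
      then show ?thesis using sum_symmetric_tendsto S by simp
    next
      case False
      then show ?thesis using S[of \<omega>] infsum_not_exists[of "\<lambda>i. f i \<omega>" UNIV] by simp
    qed
  qed
qed

section \<open>Infinite sums\<close>

text \<open>Truncations are almost surely within a deterministic distance tending to 0, so tail
  events are sandwiched after a small shift of the threshold. As the law of the sum may have atoms,
  the two directions remove the shift differently. The bounds 1 here against 2 for finite chains
  leave room for passing to the limit.\<close>

lemma (in prob_space) Gsum_tail_bound:
  fixes X :: "int \<Rightarrow> 'a \<Rightarrow> real" and a :: "int \<Rightarrow> real"
  defines "E \<equiv> expectation (Gsum a X)" and "V \<equiv> variance (Gsum a X)"
  defines "C \<equiv> sqrt (\<Sum>\<^sub>\<infinity>i. a i ^ 4) / V"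
  assumes ind: "indep_vars (\<lambda>_. borel) X UNIV"
    and 1: "\<And>i. prob {\<omega> \<in> space M. X i \<omega> = 1} = 1/2"
    and 2: "\<And>i. prob {\<omega> \<in> space M. X i \<omega> = -1} = 1/2"
    and a: "a summable_on UNIV"
    and V: "V > 0" and z: "0 \<le> z" "z ^ 3 * C \<le> 1" "C \<le> 1"
  shows "\<bar>prob {\<omega> \<in> space M. Gsum a X \<omega> > E + z * sqrt V} - (1 - Phi z)\<bar>
    \<le> tail_const * C * (1 - Phi z) * ((1 + z) * (1 + z\<^sup>2))"
proof -
  have X [measurable]: "X i \<in> borel_measurable M" for i
    using ind by (auto simp: indep_vars_def)
  let ?K = "\<lambda>N::nat. {- int N..int N}"
  define G where "G = Gsum a X"
  define Gn where "Gn N = Gpart N a X" for N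
  have [measurable]: "G \<in> borel_measurable M"
    unfolding G_def Gsum_def[abs_def] xi_def by (intro borel_measurable_infsum_int) measurable
  have [measurable]: "Gn N \<in> borel_measurable M" for N
    unfolding Gn_def Gpart_def[abs_def] xi_def by measurable

  have abs_a: "(\<lambda>i. \<bar>a i\<bar>) summable_on UNIV"
    using a summable_on_iff_abs_summable_on_real[of a UNIV] by simp
  define S where "S = (\<Sum>\<^sub>\<infinity>i. \<bar>a i\<bar>)"
  define \<epsilon> where "\<epsilon> N = (\<Sum>\<^sub>\<infinity>i\<in>- ?K N. \<bar>a i\<bar>)" for N
  have S_split: "S = (\<Sum>i\<in>?K N. \<bar>a i\<bar>) + \<epsilon> N" for N
  proof -
    have "S = (\<Sum>\<^sub>\<infinity>i\<in>?K N \<union> - ?K N. \<bar>a i\<bar>)" by (simp add: S_def Compl_partition)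
    also have "\<dots> = (\<Sum>\<^sub>\<infinity>i\<in>?K N. \<bar>a i\<bar>) + \<epsilon> N"
      unfolding \<epsilon>_def by (rule infsum_Un_disjoint) (auto intro: summable_on_subset_banach[OF abs_a])
    finally show ?thesis by simp
  qed
  have \<epsilon>_lim: "\<epsilon> \<longlonglongrightarrow> 0"
  proof -
    have "(\<lambda>N. S - (\<Sum>i\<in>?K N. \<bar>a i\<bar>)) \<longlonglongrightarrow> S - S"
      unfolding S_def by (intro tendsto_diff tendsto_const sum_symmetric_tendsto abs_a)
    moreover have "S - (\<Sum>i\<in>?K N. \<bar>a i\<bar>) = \<epsilon> N" for N using S_split[of N] by simp
    ultimately show ?thesis by simp
  qed
  have \<epsilon>_nonneg: "\<epsilon> N \<ge> 0" for N unfolding \<epsilon>_def by (rule infsum_nonneg) simp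
  have a_le_S: "\<bar>a i\<bar> \<le> S" for i
    using finite_sum_le_infsum[OF abs_a, of "{i}"] by (simp add: S_def)
  have S0: "S \<ge> 0" using a_le_S[of 0] by linarith

  \<comment> \<open>Off a null set every \<open>xi\<close> is 0 or 1, so each term is dominated by
    the absolute value of its coefficient, uniformly in \<open>\<omega>\<close>.\<close>
  have near: "AE \<omega> in M. \<forall>N. \<bar>G \<omega> - Gn N \<omega>\<bar> \<le> \<epsilon> N \<and> \<bar>Gn N \<omega>\<bar> \<le> S"
    using AE_values[of X, OF X 1 2]
  proof eventually_elim
    case (elim \<omega>)
    define f where "f i = a i * xi X i \<omega> * xi X (i + 1) \<omega>" for i
    have xi01: "xi X i \<omega> = 0 \<or> xi X i \<omega> = 1" for i
      using elim[rule_format, of i] by (auto simp: xi_def)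
    have fa: "\<bar>f i\<bar> \<le> \<bar>a i\<bar>" for i
      using xi01[of i] xi01[of "i + 1"] by (auto simp: f_def)
    have abs_f: "(\<lambda>i. \<bar>f i\<bar>) summable_on UNIV"
      using Infinite_Sum.abs_summable_on_comparison_test'[of "\<lambda>i. \<bar>a i\<bar>" UNIV f] abs_a fa by simp
    have f: "f summable_on UNIV"
      using abs_f summable_on_iff_abs_summable_on_real[of f UNIV] by simp
    show ?case
    proof (intro allI conjI)
      fix N
      have "G \<omega> = (\<Sum>\<^sub>\<infinity>i\<in>?K N \<union> - ?K N. f i)" by (simp add: G_def Gsum_def f_def Compl_partition)
      also have "\<dots> = (\<Sum>\<^sub>\<infinity>i\<in>?K N. f i) + (\<Sum>\<^sub>\<infinity>i\<in>- ?K N. f i)"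
        by (rule infsum_Un_disjoint) (auto intro: summable_on_subset_banach[OF f])
      also have "(\<Sum>\<^sub>\<infinity>i\<in>?K N. f i) = Gn N \<omega>" by (simp add: Gn_def Gpart_def f_def)
      finally have "\<bar>G \<omega> - Gn N \<omega>\<bar> = \<bar>\<Sum>\<^sub>\<infinity>i\<in>- ?K N. f i\<bar>" by simp
      also have "\<dots> \<le> (\<Sum>\<^sub>\<infinity>i\<in>- ?K N. \<bar>f i\<bar>)"
        using norm_infsum_bound[of f "- ?K N"] summable_on_subset_banach[OF abs_f, of "- ?K N"] by simp
      also have "\<dots> \<le> \<epsilon> N"
        unfolding \<epsilon>_def by (intro infsum_mono fa) (auto intro: summable_on_subset_banach abs_f abs_a)
      finally show "\<bar>G \<omega> - Gn N \<omega>\<bar> \<le> \<epsilon> N" .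
      have "\<bar>Gn N \<omega>\<bar> \<le> (\<Sum>i\<in>?K N. \<bar>f i\<bar>)"
        unfolding Gn_def Gpart_def f_def[symmetric] by (rule sum_abs)
      also have "\<dots> \<le> (\<Sum>i\<in>?K N. \<bar>a i\<bar>)" by (intro sum_mono fa)
      also have "\<dots> \<le> S" using S_split[of N] \<epsilon>_nonneg[of N] by simp
      finally show "\<bar>Gn N \<omega>\<bar> \<le> S" .
    qed
  qed
  have lim: "AE \<omega> in M. (\<lambda>N. Gn N \<omega>) \<longlonglongrightarrow> G \<omega>"
    using near
  proof eventually_elim
    case (elim \<omega>)
    then have "\<forall>N. dist (Gn N \<omega>) (G \<omega>) \<le> \<epsilon> N" by (simp add: dist_real_def abs_minus_commute)
    then show ?case
      by (intro metric_tendsto_imp_tendsto[OF \<epsilon>_lim]) (auto simp: \<epsilon>_nonneg)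
  qed
  have G_le: "AE \<omega> in M. \<bar>G \<omega>\<bar> \<le> S"
    using near lim
  proof eventually_elim
    case (elim \<omega>)
    show ?case by (rule LIMSEQ_le_const2[OF tendsto_rabs[OF elim(2)]]) (use elim(1) in auto)
  qed
  have sq_le: "r\<^sup>2 \<le> S\<^sup>2" if "\<bar>r\<bar> \<le> S" for r using that S0 by (simp add: abs_le_square_iff[symmetric])
  have sq_bounded: "AE \<omega> in M. norm ((Y \<omega>)\<^sup>2) \<le> S\<^sup>2" if "AE \<omega> in M. \<bar>Y \<omega>\<bar> \<le> S" for Y
    using that by eventually_elim (simp add: sq_le)
  have Gn_le: "AE \<omega> in M. \<bar>Gn N \<omega>\<bar> \<le> S" for N
    using near by eventually_elim simp
  have int: "integrable M G" "integrable M (\<lambda>\<omega>. (G \<omega>)\<^sup>2)"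
    using G_le by (auto intro: integrable_const_bound[where B = S] integrable_const_bound[OF sq_bounded])
  have intn: "integrable M (Gn N)" "integrable M (\<lambda>\<omega>. (Gn N \<omega>)\<^sup>2)" for N
    using Gn_le[of N] by (auto intro: integrable_const_bound[where B = S] integrable_const_bound[OF sq_bounded])

  define En where "En N = expectation (Gn N)" for N
  define Vn where "Vn N = variance (Gn N)" for N
  have En_lim: "En \<longlonglongrightarrow> E"
    unfolding En_def E_def G_def[symmetric]
  proof (rule integral_dominated_convergence[where w = "\<lambda>_. S"])
    show "AE \<omega> in M. norm (Gn N \<omega>) \<le> S" for N using Gn_le[of N] by simp
  qed (use lim in auto)
  have "(\<lambda>N. expectation (\<lambda>\<omega>. (Gn N \<omega>)\<^sup>2)) \<longlonglongrightarrow> expectation (\<lambda>\<omega>. (G \<omega>)\<^sup>2)"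
  proof (rule integral_dominated_convergence[where w = "\<lambda>_. S\<^sup>2"])
    show "AE \<omega> in M. norm ((Gn N \<omega>)\<^sup>2) \<le> S\<^sup>2" for N by (rule sq_bounded[OF Gn_le])
    show "AE \<omega> in M. (\<lambda>N. (Gn N \<omega>)\<^sup>2) \<longlonglongrightarrow> (G \<omega>)\<^sup>2" using lim by eventually_elim (rule tendsto_power)
  qed auto
  then have Vn_lim: "Vn \<longlonglongrightarrow> V"
    unfolding Vn_def V_def G_def[symmetric] variance_eq[OF int] variance_eq[OF intn]
    using En_lim unfolding En_def E_def G_def[symmetric] by (intro tendsto_diff tendsto_power) auto

  define Cn where "Cn N = sqrt (\<Sum>i\<in>?K N. a i ^ 4) / Vn N" for N
  have a4: "(\<lambda>i. a i ^ 4) summable_on UNIV"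
  proof -
    have "(\<lambda>i. S ^ 3 * \<bar>a i\<bar>) summable_on UNIV" by (intro summable_on_cmult_right abs_a)
    moreover have "norm (a i ^ 4) \<le> S ^ 3 * \<bar>a i\<bar>" for i
    proof -
      have "norm (a i ^ 4) = \<bar>a i\<bar> ^ 3 * \<bar>a i\<bar>" by (simp add: power_abs eval_nat_numeral abs_mult)
      also have "\<dots> \<le> S ^ 3 * \<bar>a i\<bar>" by (intro mult_right_mono power_mono a_le_S) auto
      finally show ?thesis .
    qed
    ultimately have "(\<lambda>i. norm (a i ^ 4)) summable_on UNIV"
      by (rule Infinite_Sum.abs_summable_on_comparison_test')
    then show ?thesis by (rule abs_summable_summable)
  qed
  have Cn_lim: "Cn \<longlonglongrightarrow> C"
    unfolding Cn_def C_def using V by (intro tendsto_divide tendsto_real_sqrt sum_symmetric_tendsto a4 Vn_lim) auto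

  define T where "T y = (1 - Phi y) * ((1 + y) * (1 + y\<^sup>2))" for y
  define q where "q = E + z * sqrt V"
  \<comment> \<open>The strict inequality is an open condition, so it passes from \<open>C\<close>
    to \<open>Cn N\<close> for large \<open>N\<close>. A general \<open>y\<close> is allowed because
    the lower bound uses levels slightly above \<open>z\<close>.\<close>
  have bound: "\<forall>\<^sub>F N in sequentially. \<bar>prob {\<omega> \<in> space M. Gn N \<omega> > En N + y * sqrt (Vn N)} - (1 - Phi y)\<bar>
      \<le> tail_const * Cn N * T y" if y: "0 \<le> y" "y ^ 3 * C < 2" for y
  proof -
    have "\<forall>\<^sub>F N in sequentially. 0 < Vn N" using Vn_lim V by (rule order_tendstoD)
    moreover have "\<forall>\<^sub>F N in sequentially. y ^ 3 * Cn N < 2"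
      using tendsto_mult_left[OF Cn_lim] y(2) by (rule order_tendstoD)
    moreover have "\<forall>\<^sub>F N in sequentially. Cn N < 2"
      using Cn_lim by (rule order_tendstoD) (use z in simp)
    ultimately show ?thesis
    proof eventually_elim
      case (elim N)
      show ?case
        using Gpart_tail_bound[OF ind 1 2, of N a y] elim y(1)
        unfolding Gn_def En_def Vn_def Cn_def T_def by (simp add: mult.assoc)
    qed
  qed
  have bound_lim: "(\<lambda>N. tail_const * Cn N * T y) \<longlonglongrightarrow> tail_const * C * T y" for y
    by (intro tendsto_intros Cn_lim)
  have q_lim: "(\<lambda>N. En N + y * sqrt (Vn N)) \<longlonglongrightarrow> E + y * sqrt V" for y
    by (intro tendsto_intros En_lim Vn_lim)
  have sV: "sqrt V > 0" using V by simp

  have "prob {\<omega> \<in> space M. G \<omega> > q} \<le> (1 - Phi z) + tail_const * C * T z"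
  proof (rule LIMSEQ_le_const2)
    \<comment> \<open>For the upper bound the threshold of the full sum is raised by
      \<open>\<delta>\<close>, which eventually exceeds the truncation error. The shift is removed
      by continuity of the measure from below.\<close>
    have *: "prob {\<omega> \<in> space M. G \<omega> > q + \<delta>} \<le> (1 - Phi z) + tail_const * C * T z" if "\<delta> > 0" for \<delta>
    proof (rule tendsto_lowerbound)
      show "(\<lambda>N. (1 - Phi z) + tail_const * Cn N * T z) \<longlonglongrightarrow> (1 - Phi z) + tail_const * C * T z"
        by (intro tendsto_add tendsto_const bound_lim)
      have "(\<lambda>N. (En N + z * sqrt (Vn N)) + \<epsilon> N) \<longlonglongrightarrow> q + 0"
        unfolding q_def by (intro tendsto_add q_lim \<epsilon>_lim)
      then have "\<forall>\<^sub>F N in sequentially. (En N + z * sqrt (Vn N)) + \<epsilon> N < q + \<delta>"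
        by (rule order_tendstoD) (use that in simp)
      moreover have "z ^ 3 * C < 2" using z by simp
      note bound[OF z(1) this]
      ultimately show "\<forall>\<^sub>F N in sequentially. prob {\<omega> \<in> space M. G \<omega> > q + \<delta>} \<le> (1 - Phi z) + tail_const * Cn N * T z"
      proof eventually_elim
        case (elim N)
        have "AE \<omega> in M. \<omega> \<in> {\<omega> \<in> space M. G \<omega> > q + \<delta>} \<longrightarrow> \<omega> \<in> {\<omega> \<in> space M. Gn N \<omega> > En N + z * sqrt (Vn N)}"
          using near
        proof eventually_elim
          case (elim \<omega>)
          then have "\<bar>G \<omega> - Gn N \<omega>\<bar> \<le> \<epsilon> N" by blast
          then show ?case using \<open>(En N + z * sqrt (Vn N)) + \<epsilon> N < q + \<delta>\<close> by auto
        qed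
        then have "prob {\<omega> \<in> space M. G \<omega> > q + \<delta>} \<le> prob {\<omega> \<in> space M. Gn N \<omega> > En N + z * sqrt (Vn N)}"
          by (rule finite_measure_mono_AE) measurable
        with elim(2) show ?case by linarith
      qed
    qed simp
    show "\<exists>N. \<forall>m\<ge>N. prob {\<omega> \<in> space M. G \<omega> > q + 1 / real (Suc m)} \<le> (1 - Phi z) + tail_const * C * T z"
      by (auto intro!: *)
    have "(\<lambda>m. prob {\<omega> \<in> space M. G \<omega> > q + 1 / real (Suc m)}) \<longlonglongrightarrow> prob (\<Union>m. {\<omega> \<in> space M. G \<omega> > q + 1 / real (Suc m)})"
    proof (rule finite_Lim_measure_incseq)
      show "incseq (\<lambda>m. {\<omega> \<in> space M. G \<omega> > q + 1 / real (Suc m)})"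
      proof (rule incseq_SucI, safe)
        fix m \<omega> assume "G \<omega> > q + 1 / real (Suc m)"
        moreover have "1 / real (Suc (Suc m)) \<le> 1 / real (Suc m)" by (intro divide_left_mono) auto
        ultimately show "G \<omega> > q + 1 / real (Suc (Suc m))" by linarith
      qed
    qed auto
    also have "(\<Union>m. {\<omega> \<in> space M. G \<omega> > q + 1 / real (Suc m)}) = {\<omega> \<in> space M. G \<omega> > q}"
    proof safe
      fix m \<omega> assume "G \<omega> > q + 1 / real (Suc m)"
      moreover have "1 / real (Suc m) > 0" by simp
      ultimately show "G \<omega> > q" by linarith
    next
      fix \<omega> assume "\<omega> \<in> space M" "G \<omega> > q"
      moreover obtain m where "1 / real (Suc m) < G \<omega> - q"
        using nat_approx_posE[of "G \<omega> - q"] \<open>G \<omega> > q\<close> by auto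
      ultimately show "\<omega> \<in> (\<Union>m. {\<omega> \<in> space M. G \<omega> > q + 1 / real (Suc m)})"
        by (auto intro!: exI[of _ m])
    qed
    finally show "(\<lambda>m. prob {\<omega> \<in> space M. G \<omega> > q + 1 / real (Suc m)}) \<longlonglongrightarrow> prob {\<omega> \<in> space M. G \<omega> > q}" .
  qed
  \<comment> \<open>For the lower bound the truncated sum is required to exceed a level
    \<open>y > z\<close>, which forces the full sum above \<open>q\<close>. Then \<open>y\<close>
    decreases to \<open>z\<close>, by continuity of \<open>Phi\<close>.\<close>
  moreover have "(1 - Phi z) - tail_const * C * T z \<le> prob {\<omega> \<in> space M. G \<omega> > q}"
  proof (rule tendsto_upperbound)
    have Phi: "isCont Phi z" by (rule DERIV_isCont[OF DERIV_Phi])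
    have Pz: "(Phi \<longlongrightarrow> Phi z) (at_right z)"
      using Phi unfolding isCont_def by (rule tendsto_within_subset) simp
    have "((\<lambda>y. (1 - Phi y) - tail_const * C * T y) \<longlongrightarrow> (1 - Phi z) - tail_const * C * T z) (at_right z)"
      unfolding T_def by (intro tendsto_intros Pz)
    then show "((\<lambda>y. (1 - Phi y) - tail_const * C * T y) \<longlongrightarrow> (1 - Phi z) - tail_const * C * T z) (at_right z)" .
    have "((\<lambda>y. y ^ 3 * C) \<longlongrightarrow> z ^ 3 * C) (at_right z)" by (intro tendsto_intros)
    then have "\<forall>\<^sub>F y in at_right z. y ^ 3 * C < 2"
      by (rule order_tendstoD) (use z in simp)
    moreover have "\<forall>\<^sub>F y in at_right z. z < y" by (rule eventually_at_right_less)
    ultimately show "\<forall>\<^sub>F y in at_right z. (1 - Phi y) - tail_const * C * T y \<le> prob {\<omega> \<in> space M. G \<omega> > q}"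
    proof eventually_elim
      case (elim y)
      show ?case
      proof (rule tendsto_upperbound)
        show "(\<lambda>N. (1 - Phi y) - tail_const * Cn N * T y) \<longlonglongrightarrow> (1 - Phi y) - tail_const * C * T y"
          by (intro tendsto_diff tendsto_const bound_lim)
        have "(\<lambda>N. (En N + y * sqrt (Vn N)) - \<epsilon> N) \<longlonglongrightarrow> (E + y * sqrt V) - 0"
          by (intro tendsto_diff q_lim \<epsilon>_lim)
        moreover have "q < (E + y * sqrt V) - 0" using elim sV by (simp add: q_def)
        ultimately have "\<forall>\<^sub>F N in sequentially. q < (En N + y * sqrt (Vn N)) - \<epsilon> N"
          by (rule order_tendstoD)
        moreover have "0 \<le> y" using elim z by simp
        note bound[OF this elim(1)]
        ultimately show "\<forall>\<^sub>F N in sequentially. (1 - Phi y) - tail_const * Cn N * T y \<le> prob {\<omega> \<in> space M. G \<omega> > q}"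
        proof eventually_elim
          case (elim N)
          have "AE \<omega> in M. \<omega> \<in> {\<omega> \<in> space M. Gn N \<omega> > En N + y * sqrt (Vn N)} \<longrightarrow> \<omega> \<in> {\<omega> \<in> space M. G \<omega> > q}"
            using near
          proof eventually_elim
            case (elim \<omega>)
            then have "\<bar>G \<omega> - Gn N \<omega>\<bar> \<le> \<epsilon> N" by blast
            then show ?case using \<open>q < (En N + y * sqrt (Vn N)) - \<epsilon> N\<close> by auto
          qed
          then have "prob {\<omega> \<in> space M. Gn N \<omega> > En N + y * sqrt (Vn N)} \<le> prob {\<omega> \<in> space M. G \<omega> > q}"
            by (rule finite_measure_mono_AE) measurable
          with elim(2) show ?case by linarith
        qed
      qed simp
    qed
  qed simp
  ultimately show ?thesis
    unfolding G_def q_def T_def by (simp add: abs_le_iff algebra_simps)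
qed

section \<open>The l^4 norm and the final estimate\<close>

lemma lp_norm_4_square: "(lp_norm 4 a)\<^sup>2 = sqrt (\<Sum>\<^sub>\<infinity>i. a i ^ 4)"
proof -
  have p: "\<bar>a i\<bar> powr 4 = a i ^ 4" for i
  proof (cases "a i = 0")
    case False
    then have "\<bar>a i\<bar> powr real 4 = \<bar>a i\<bar> ^ 4" by (intro powr_realpow) simp
    then show ?thesis by simp
  qed simp
  have "(lp_norm 4 a)\<^sup>2 = (\<Sum>\<^sub>\<infinity>i. a i ^ 4) powr (1 / 4) * (\<Sum>\<^sub>\<infinity>i. a i ^ 4) powr (1 / 4)"
    by (simp add: lp_norm_def p power2_eq_square)
  also have "\<dots> = (\<Sum>\<^sub>\<infinity>i. a i ^ 4) powr (1 / 2)" by (simp flip: powr_add)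
  also have "\<dots> = sqrt (\<Sum>\<^sub>\<infinity>i. a i ^ 4)" by (rule powr_half_sqrt) (simp add: infsum_nonneg)
  finally show ?thesis .
qed

theorem theorem1p1:
  fixes M :: "'w measure" and X :: "int \<Rightarrow> 'w \<Rightarrow> real" and a :: "nat \<Rightarrow> int \<Rightarrow> real"
  assumes "prob_space M"
    and "prob_space.indep_vars M (\<lambda>_. borel) X UNIV"
    and "\<And>i. measure M {\<omega> \<in> space M. X i \<omega> = 1} = 1/2"
    and "\<And>i. measure M {\<omega> \<in> space M. X i \<omega> = -1} = 1/2"
    and "\<And>n. a n summable_on UNIV"
    and "\<And>n. prob_space.variance M (Gsum (a n) X) > 0"
  shows "\<exists>K>0. \<exists>c>0. \<forall>n. \<forall>z::real.
    (let V = prob_space.variance M (Gsum (a n) X);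
         E = prob_space.expectation M (Gsum (a n) X);
         F = (\<lambda>\<omega>. (Gsum (a n) X \<omega> - E) / sqrt V);
         C = (lp_norm 4 (a n))\<^sup>2 / V;
         \<gamma> = exp (c * z * V powr (-1/2)) * (sqrt z * sqrt C + (1 + sqrt z + z) * C)
     in (0 \<le> z \<and> z \<le> Min {C powr (-1/5), C powr (-1/3), C powr (-2/5), sqrt V}
         \<and> (1 + z\<^sup>2) * \<gamma> \<le> 1)
        \<longrightarrow> \<bar>measure M {\<omega> \<in> space M. F \<omega> > z} / (1 - Phi z) - 1\<bar> \<le> K * (1 + z\<^sup>2) * \<gamma>)"
proof -
  interpret prob_space M by fact
  have main: "\<bar>prob {\<omega> \<in> space M. (Gsum (a n) X \<omega> - E) / sqrt V > z} / (1 - Phi z) - 1\<bar> \<le> tail_const * (1 + z\<^sup>2) * \<gamma>"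
    if V: "V = variance (Gsum (a n) X)" and E: "E = expectation (Gsum (a n) X)"
      and C: "C = (lp_norm 4 (a n))\<^sup>2 / V"
      and \<gamma>: "\<gamma> = exp (1 * z * V powr (-1/2)) * (sqrt z * sqrt C + (1 + sqrt z + z) * C)"
      and z: "0 \<le> z" "z \<le> Min {C powr (-1/5), C powr (-1/3), C powr (-2/5), sqrt V}"
      and le_1: "(1 + z\<^sup>2) * \<gamma> \<le> 1"
    for n z V E C \<gamma>
  proof -
    have V0: "V > 0" using assms(6)[of n] V by simp
    have C': "C = sqrt (\<Sum>\<^sub>\<infinity>i. a n i ^ 4) / V" by (simp add: C lp_norm_4_square)
    have C0: "C \<ge> 0" using V0 by (simp add: C)
    \<comment> \<open>The exponential is at least 1 and the bracket contains (1 + z) C, so the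
      sharper error (1 + z)(1 + z^2) C is dominated by (1 + z^2) \<open>\<gamma>\<close>.\<close>
    have "1 * ((1 + z) * C) \<le> exp (1 * z * V powr (-1/2)) * (sqrt z * sqrt C + (1 + sqrt z + z) * C)"
    proof (intro mult_mono)
      have "(1 + z) * C \<le> (1 + sqrt z + z) * C" using z C0 by (intro mult_right_mono) auto
      moreover have "0 \<le> sqrt z * sqrt C" using z C0 by simp
      ultimately show "(1 + z) * C \<le> sqrt z * sqrt C + (1 + sqrt z + z) * C" by linarith
    qed (use z C0 in auto)
    then have \<gamma>_ge: "(1 + z) * C \<le> \<gamma>" by (simp add: \<gamma>)
    \<comment> \<open>The assumption that (1 + z^2) \<open>\<gamma>\<close> is at most 1 thus yields
      C <= 1.\<close>
    have "1 * ((1 + z) * C) \<le> (1 + z\<^sup>2) * \<gamma>"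
      using z C0 \<gamma>_ge by (intro mult_mono) auto
    then have "(1 + z) * C \<le> 1" using le_1 by linarith
    moreover have "1 * C \<le> (1 + z) * C" using z C0 by (intro mult_right_mono) auto
    ultimately have C1: "C \<le> 1" by linarith
    have "z \<le> C powr (-1/3)" using z(2) by simp
    \<comment> \<open>The value C = 0 is treated separately: there \<open>powr\<close> returns 0 and
      its cube is not 1 / C, but the inequality is trivial.\<close>
    have zC: "z ^ 3 * C \<le> 1"
    proof (cases "C = 0")
      case False
      with C0 have Cp: "C > 0" by simp
      have "z ^ 3 \<le> (C powr (-1/3)) ^ 3" using z \<open>z \<le> C powr (-1/3)\<close> by (intro power_mono) auto
      also have "\<dots> = C powr (-1)" using Cp by (simp add: powr_power)
      also have "\<dots> = 1 / C" using Cp by (simp add: powr_minus divide_inverse)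
      finally show ?thesis using Cp by (simp add: field_simps)
    qed simp
    have "(Gsum (a n) X \<omega> - E) / sqrt V > z \<longleftrightarrow> Gsum (a n) X \<omega> > E + z * sqrt V" for \<omega>
      using V0 by (auto simp: field_simps)
    then have "\<bar>prob {\<omega> \<in> space M. (Gsum (a n) X \<omega> - E) / sqrt V > z} - (1 - Phi z)\<bar>
        \<le> tail_const * C * (1 - Phi z) * ((1 + z) * (1 + z\<^sup>2))"
      using Gsum_tail_bound[OF assms(2-5), of n z] V0 z(1) zC C1 unfolding C' V E by simp
    also have "\<dots> = (1 - Phi z) * (tail_const * (1 + z\<^sup>2) * ((1 + z) * C))" by simp
    also have "\<dots> \<le> (1 - Phi z) * (tail_const * (1 + z\<^sup>2) * \<gamma>)"
      using Phi_less_1[of z] tail_const_pos \<gamma>_ge by (intro mult_left_mono) auto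
    finally have *: "\<bar>prob {\<omega> \<in> space M. (Gsum (a n) X \<omega> - E) / sqrt V > z} - (1 - Phi z)\<bar>
        \<le> (1 - Phi z) * (tail_const * (1 + z\<^sup>2) * \<gamma>)" .
    have "p / (1 - Phi z) - 1 = (p - (1 - Phi z)) / (1 - Phi z)" for p
      using Phi_less_1[of z] by (simp add: diff_divide_distrib)
    then show ?thesis
      using * Phi_less_1[of z] by (simp add: abs_divide pos_divide_le_eq mult.commute)
  qed
  show ?thesis
    unfolding Let_def
    by (rule exI[of _ tail_const], rule conjI[OF tail_const_pos], rule exI[of _ 1], rule conjI[OF zero_less_one])
       (intro allI impI, elim conjE, rule main[OF refl refl refl refl])
qed

end
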